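(* Let $\mathcal F=\{a_1,\dots,a_s\}$ be a finite reduced collection of forbidden words over a symbol set $\Sigma$ of size $q\ge2$ with $\Sigma_{\mathcal F}$ irreducible, let $\mathcal R=\{r_1(m_1),\dots,r_\ell(m_\ell)\}$ be a reduced collection of repeated words, let $p\ge2$ be the length of the longest word in $\mathcal F\cup\mathcal R$, and suppose all words in $\mathcal R$ have length $p$. Let $A$ be the adjacency matrix associated with $\mathcal F$ and $\mathcal R$, $\theta$ its Perron root, and assume $\theta>1$. Let $U=(U_X)$, $V=(V_X)$, $X\in\mathcal L_{p-1}$, be the left and right Perron eigenvectors of $A$ given by $$U_X=1-\theta\sum_{i=1}^{\ell}\Bigl(1-\frac1{m_i}\Bigr)R_i(\theta)(\tilde r_i,X)_\theta+\theta\sum_{j=1}^{s}R_{\ell+j}(\theta)(\tilde a_j,X)_\theta,$$ $$V_X=1-\theta\sum_{i=1}^{\ell}\Bigl(1-\frac1{m_i}\Bigr)S_i(\theta)(X,r_i)_\theta+\theta\sum_{j=1}^{s}S_{\ell+j}(\theta)(X,a_j)_\theta .$$ If the edge shift $\Sigma_A$ satisfies property (P), then $$U^TV=\theta^{p-1}\bigl(1+R'(\theta)\bigr),$$ where $R'(\theta)$ is the derivative at $z=\theta$ of $$R(z)=z\sum_{i=1}^{\ell}\Bigl(1-\frac1{m_i}\Bigr)R_i(z)-z\sum_{j=1}^{s}R_{\ell+j}(z).$$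
   Context: $\Sigma$ is a finite set of $q$ symbols; a word is a finite sequence over $\Sigma$ and $|w|$ is its length. A collection of words is reduced if for any two distinct words in it neither is a (contiguous) subword of the other. $\mathcal F$ is a finite reduced collection of words of length at least $2$; $\Sigma_{\mathcal F}\subseteq\Sigma^{\mathbb N}$ is the set of one-sided sequences containing no word of $\mathcal F$. A word is allowed if it is a subword of some sequence in $\Sigma_{\mathcal F}$; $\mathcal L_n$ is the set of allowed words of length $n$. All symbols are assumed allowed. $\Sigma_{\mathcal F}$ is irreducible: for all allowed $u,v$ there is a word $w$ with $uwv$ allowed. $\mathcal R$ is a finite reduced collection of allowed words $r_1,\dots,r_\ell$, each $r_i$ assigned an integer multiplicity $m_i\ge2$. For an allowed word $w$, $m(w)=\prod_{i}m_i^{n(w;r_i)}$, where $n(w;r_i)$ is the number of occurrences of $r_i$ as a subword of $w$. For $X=x_1\dots x_{p-1}$, $Y=y_1\dots y_{p-1}$ in $\mathcal L_{p-1}$, $X*Y$ is defined only if $x_2\dots x_{p-1}=y_1\dots y_{p-2}$ (no condition if $p=2$), and then $X*Y=x_1\dots x_{p-1}y_{p-1}$. Since all words of $\mathcal R$ have length $p$, the adjacency matrix $A$ associated with $\mathcal F$ and $\mathcal R$ is indexed by $\mathcal L_{p-1}$, with $A_{XY}=m(X*Y)$ if $X*Y$ is defined and lies in $\mathcal L_p$, and $A_{XY}=0$ otherwise. $\mathcal G_A$ is the directed multigraph with vertex set $\mathcal L_{p-1}$ and edges $(X*Y)_1,\dots,(X*Y)_{A_{XY}}$ from $X$ to $Y$;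 $\Sigma_A$ is the set of one-sided infinite paths of edges in $\mathcal G_A$. To a word $W=(X_1*X_2)_{i_1}\dots(X_{n-p+1}*X_{n-p+2})_{i_{n-p+1}}$ of $\Sigma_A$ is associated the unique $w=x_1\dots x_n\in\mathcal L_n$ with $X_i=x_i\dots x_{i+p-2}$. Property (P): there exist $X,Y\in\mathcal L_{p-1}$, a point $\alpha=\alpha_1\alpha_2\dots\in\Sigma_A$ and a strictly increasing sequence $(n_k)_{k\ge1}$ of natural numbers such that for each $k$, $W_{n_k-p+1}=\alpha_1\dots\alpha_{n_k-p+1}$ is a path from vertex $X$ to vertex $Y$ and $m(w_{n_k})=1$, where $w_{n_k}\in\mathcal L_{n_k}$ is the word associated to $W_{n_k-p+1}$. Correlation: for words $u,v$, $(u,v)=(c_1,\dots,c_{|u|})$ where $c_i=1$ if, placing $v$ below $u$ so that the leftmost symbol of $v$ lies under the $i$-th symbol of $u$, the overlapping segments are identical, and $c_i=0$ otherwise; $(u,v)_z=\sum_{i=1}^{|u|}c_iz^{|u|-i}$, and $(u,v)_\theta$ is its value at $z=\theta$. $\tilde w$ denotes $w$ with its first symbol removed. $P(z)$ is the $(\ell+s)\times(\ell+s)$ matrix $$P(z)_{ij}=\begin{cases}z(1-\frac1{m_j})(r_j,r_i)_z-\delta_{ij}z^{|r_j|}, & 1\le i,j\le\ell,\\ -z(a_{j-\ell},r_i)_z, & i\le\ell<j,\\ z(1-\frac1{m_j})(r_j,a_{i-\ell})_z, & j\le\ell<i,\\ -z(a_{j-\ell},a_{i-\ell})_z, & i,j>\ell,\end{cases}$$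 which is invertible over the rational functions. $D(z)$ is diagonal with $D_{ii}(z)=z(1-\frac1{m_i})$ for $1\le i\le\ell$ and $D_{ii}(z)=-z$ for $\ell<i\le\ell+s$; $Q=D^{-1}P^TD$. $R_i(z)$ and $S_i(z)$ are the $i$-th row sums of $P^{-1}(z)$ and $Q^{-1}(z)$, viewed as rational functions; their values at $\theta$ exist. *)

theory Defs
  imports
    "HOL-Library.Sublist"
    "HOL-Computational_Algebra.Polynomial_Factorial"
    "Graph_Theory.Arc_Walk"
    "Jordan_Normal_Form.Gauss_Jordan_Elimination"
    "Jordan_Normal_Form.Spectral_Radius"
begin

text \<open>
  Words are lists over a finite type of symbols and one-sided sequences are functions on
  \<^typ>\<open>nat\<close>; all indices start at 0.  The forbidden words are a list \<open>a\<close>, the repeated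
  words a list \<open>r\<close>, and \<open>m\<close> is the list of multiplicities, so that \<open>r ! i\<close> has
  multiplicity \<open>m ! i\<close>.
\<close>

section \<open>Shift spaces\<close>

definition reduced :: "'a list set \<Rightarrow> bool" where
  "reduced C \<longleftrightarrow> (\<forall>u\<in>C. \<forall>v\<in>C. u \<noteq> v \<longrightarrow> \<not> sublist u v)"

definition subword_of_seq :: "'a list \<Rightarrow> (nat \<Rightarrow> 'a) \<Rightarrow> bool" where
  "subword_of_seq w x \<longleftrightarrow> (\<exists>k. map x [k..<k + length w] = w)"

definition shift_space :: "'a list set \<Rightarrow> (nat \<Rightarrow> 'a) set" where
  "shift_space F = {x. \<forall>w\<in>F. \<not> subword_of_seq w x}"

definition allowed :: "'a list set \<Rightarrow> 'a list \<Rightarrow> bool" where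
  "allowed F w \<longleftrightarrow> (\<exists>x\<in>shift_space F. subword_of_seq w x)"

definition allowed_words :: "'a list set \<Rightarrow> nat \<Rightarrow> 'a list set" where
  "allowed_words F n = {w. allowed F w \<and> length w = n}"

definition irreducible_shift :: "'a list set \<Rightarrow> bool" where
  "irreducible_shift F \<longleftrightarrow>
     (\<forall>u v. allowed F u \<longrightarrow> allowed F v \<longrightarrow> (\<exists>w. allowed F (u @ w @ v)))"

definition occurrences :: "'a list \<Rightarrow> 'a list \<Rightarrow> nat" where
  "occurrences w u = card {k. k + length u \<le> length w \<and> take (length u) (drop k w) = u}"

definition word_mult :: "'a list list \<Rightarrow> nat list \<Rightarrow> 'a list \<Rightarrow> nat" where
  "word_mult r m w = (\<Prod>i<length r. (m ! i) ^ occurrences w (r ! i))"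

section \<open>Adjacency matrix and edge shift\<close>

definition star_defined :: "'a list \<Rightarrow> 'a list \<Rightarrow> bool" where
  "star_defined X Y \<longleftrightarrow> tl X = butlast Y"

definition star :: "'a list \<Rightarrow> 'a list \<Rightarrow> 'a list" where
  "star X Y = X @ [last Y]"

definition adj ::
  "'a list list \<Rightarrow> 'a list list \<Rightarrow> nat list \<Rightarrow> nat \<Rightarrow> 'a list \<Rightarrow> 'a list \<Rightarrow> nat"
where
  "adj a r m p X Y =
     (if star_defined X Y \<and> star X Y \<in> allowed_words (set a) p
      then word_mult r m (star X Y) else 0)"

text \<open>
  \<open>vs\<close> enumerates the index set of the matrix, the allowed words of length \<open>p - 1\<close>.
  The entries are natural numbers, embedded in the complex numbers because
  \<^const>\<open>spectral_radius\<close> is defined for complex matrices.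
\<close>

definition adjacency_mat ::
  "'a list list \<Rightarrow> 'a list list \<Rightarrow> nat list \<Rightarrow> nat \<Rightarrow> 'a list list \<Rightarrow> complex mat"
where
  "adjacency_mat a r m p vs =
     mat (length vs) (length vs) (\<lambda>(i, j). of_nat (adj a r m p (vs ! i) (vs ! j)))"

text \<open>The triple \<open>(X, Y, k)\<close> is the \<open>k\<close>-th edge from \<open>X\<close> to \<open>Y\<close>.\<close>

definition adj_graph ::
  "'a list list \<Rightarrow> 'a list list \<Rightarrow> nat list \<Rightarrow> nat \<Rightarrow>
     ('a list, 'a list \<times> 'a list \<times> nat) pre_digraph"
where
  "adj_graph a r m p =
     \<lparr> verts = allowed_words (set a) (p - 1),
       arcs = {(X, Y, k). X \<in> allowed_words (set a) (p - 1) \<and>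
                 Y \<in> allowed_words (set a) (p - 1) \<and> 1 \<le> k \<and> k \<le> adj a r m p X Y},
       tail = (\<lambda>(X, Y, k). X),
       head = (\<lambda>(X, Y, k). Y) \<rparr>"

definition edge_shift :: "('v, 'e) pre_digraph \<Rightarrow> (nat \<Rightarrow> 'e) set" where
  "edge_shift G = {\<alpha>. \<forall>i. \<alpha> i \<in> arcs G \<and> head G (\<alpha> i) = tail G (\<alpha> (Suc i))}"

text \<open>
  \<open>w\<close> is the word associated to the path \<open>W\<close> starting at \<open>X\<close>: the vertices of the path are
  the successive windows of length \<open>p - 1\<close> of \<open>w\<close>.
\<close>

definition associated_word ::
  "'a list list \<Rightarrow> 'a list list \<Rightarrow> nat list \<Rightarrow> nat \<Rightarrow> 'a list \<Rightarrow>
     ('a list \<times> 'a list \<times> nat) list \<Rightarrow> 'a list \<Rightarrow> bool"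
where
  "associated_word a r m p X W w \<longleftrightarrow>
     w \<in> allowed_words (set a) (length W + p - 1) \<and>
     (\<forall>i\<le>length W. take (p - 1) (drop i w) =
        pre_digraph.awalk_verts (adj_graph a r m p) X W ! i)"

text \<open>
  The bound \<open>p \<le> n k\<close> makes the path of length \<open>n k - p + 1\<close> nonempty and keeps the
  natural-number subtraction exact.
\<close>

definition property_P :: "'a list list \<Rightarrow> 'a list list \<Rightarrow> nat list \<Rightarrow> nat \<Rightarrow> bool" where
  "property_P a r m p \<longleftrightarrow>
     (\<exists>X \<in> allowed_words (set a) (p - 1). \<exists>Y \<in> allowed_words (set a) (p - 1).
      \<exists>\<alpha> \<in> edge_shift (adj_graph a r m p). \<exists>n :: nat \<Rightarrow> nat. strict_mono n \<and>
        (\<forall>k. p \<le> n k \<and>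
           pre_digraph.awalk (adj_graph a r m p) X (map \<alpha> [0..<n k - p + 1]) Y \<and>
           (\<exists>w. associated_word a r m p X (map \<alpha> [0..<n k - p + 1]) w \<and>
                word_mult r m w = 1)))"

section \<open>Correlation polynomials\<close>

definition corr_at :: "'a list \<Rightarrow> 'a list \<Rightarrow> nat \<Rightarrow> bool" where
  "corr_at u v i \<longleftrightarrow> (\<forall>k. i + k < length u \<and> k < length v \<longrightarrow> u ! (i + k) = v ! k)"

text \<open>The exponent is one less than in the 1-based formula \<open>z^(|u| - i)\<close>.\<close>

definition corr_poly :: "'a list \<Rightarrow> 'a list \<Rightarrow> real poly" where
  "corr_poly u v =
     (\<Sum>i<length u. if corr_at u v i then monom 1 (length u - 1 - i) else 0)"

abbreviation corr_val :: "'a list \<Rightarrow> 'a list \<Rightarrow> real \<Rightarrow> real" where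
  "corr_val u v t \<equiv> poly (corr_poly u v) t"

section \<open>The matrices \<open>P\<close> and \<open>Q\<close> over the rational functions\<close>

type_synonym ratfun = "real poly fract"

text \<open>
  The value of a rational function is computed from any representation whose denominator does
  not vanish at the point; so removable singularities are removed, and at a pole the value is
  unspecified.
\<close>

definition ratfun_val :: "ratfun \<Rightarrow> real \<Rightarrow> real" where
  "ratfun_val f t =
     (THE y. \<exists>g h. f = Fraction_Field.Fract g h \<and> poly h t \<noteq> 0 \<and> y = poly g t / poly h t)"

lemma ratfun_val_Fract:
  assumes "poly h t \<noteq> 0"
  shows "ratfun_val (Fraction_Field.Fract g h) t = poly g t / poly h t"
  unfolding ratfun_val_def
proof (rule the_equality)
  show "\<exists>g' h'. Fraction_Field.Fract g h = Fraction_Field.Fract g' h' \<and> poly h' t \<noteq> 0 \<and>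
          poly g t / poly h t = poly g' t / poly h' t"
    using assms by blast
next
  fix y
  assume "\<exists>g' h'. Fraction_Field.Fract g h = Fraction_Field.Fract g' h' \<and> poly h' t \<noteq> 0 \<and>
            y = poly g' t / poly h' t"
  then obtain g' h' where eq: "Fraction_Field.Fract g h = Fraction_Field.Fract g' h'"
    and h': "poly h' t \<noteq> 0" and y: "y = poly g' t / poly h' t" by blast
  have "h \<noteq> 0" "h' \<noteq> 0" using assms h' by auto
  with eq have "g * h' = g' * h" by (simp add: eq_fract)
  then have "poly g t * poly h' t = poly g' t * poly h t" by (metis poly_mult)
  then show "y = poly g t / poly h t" using assms h' y by (simp add: frac_eq_eq)
qed

definition P_entry :: "'a list list \<Rightarrow> 'a list list \<Rightarrow> nat list \<Rightarrow> nat \<Rightarrow> nat \<Rightarrow> real poly" where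
  "P_entry a r m i j = (let l = length r; z = [:0, 1:]; c = (\<lambda>k. [:1 - 1 / real (m ! k):]) in
     if i < l \<and> j < l then
       z * c j * corr_poly (r ! j) (r ! i) - (if i = j then z ^ length (r ! j) else 0)
     else if i < l then - (z * corr_poly (a ! (j - l)) (r ! i))
     else if j < l then z * c j * corr_poly (r ! j) (a ! (i - l))
     else - (z * corr_poly (a ! (j - l)) (a ! (i - l))))"

definition P_mat :: "'a list list \<Rightarrow> 'a list list \<Rightarrow> nat list \<Rightarrow> ratfun mat" where
  "P_mat a r m = mat (length r + length a) (length r + length a)
     (\<lambda>(i, j). to_fract (P_entry a r m i j))"

definition D_mat :: "'a list list \<Rightarrow> 'a list list \<Rightarrow> nat list \<Rightarrow> ratfun mat" where
  "D_mat a r m = mat_diag (length r + length a)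
     (\<lambda>i. to_fract (if i < length r then [:0, 1 - 1 / real (m ! i):] else [:0, - 1:]))"

text \<open>
  \<^const>\<open>mat_inverse\<close> returns an option, which is \<^const>\<open>None\<close> only for a non-invertible
  matrix.
\<close>

definition inv_mat :: "ratfun mat \<Rightarrow> ratfun mat" where
  "inv_mat M = the (mat_inverse M)"

definition Q_mat :: "'a list list \<Rightarrow> 'a list list \<Rightarrow> nat list \<Rightarrow> ratfun mat" where
  "Q_mat a r m = inv_mat (D_mat a r m) * transpose_mat (P_mat a r m) * D_mat a r m"

definition row_sum :: "ratfun mat \<Rightarrow> nat \<Rightarrow> ratfun" where
  "row_sum M i = (\<Sum>j<dim_col M. M $$ (i, j))"

definition R_fun :: "'a list list \<Rightarrow> 'a list list \<Rightarrow> nat list \<Rightarrow> nat \<Rightarrow> real \<Rightarrow> real" where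
  "R_fun a r m i = ratfun_val (row_sum (inv_mat (P_mat a r m)) i)"

definition S_fun :: "'a list list \<Rightarrow> 'a list list \<Rightarrow> nat list \<Rightarrow> nat \<Rightarrow> real \<Rightarrow> real" where
  "S_fun a r m i = ratfun_val (row_sum (inv_mat (Q_mat a r m)) i)"

definition R_total :: "'a list list \<Rightarrow> 'a list list \<Rightarrow> nat list \<Rightarrow> real \<Rightarrow> real" where
  "R_total a r m z =
     z * (\<Sum>i<length r. (1 - 1 / real (m ! i)) * R_fun a r m i z)
     - z * (\<Sum>j<length a. R_fun a r m (length r + j) z)"

end

theory Submission
  imports
    Defs
    "HOL-Analysis.Infinite_Sum"
    "HOL-Analysis.Elementary_Metric_Spaces"
begin

text \<open>
  Let \<open>gen z\<close> be the sum of \<open>m(w) z^(-|w|)\<close> over all words \<open>w\<close> without forbidden subwords, and let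
  \<open>gen_end X z\<close>, \<open>gen_start X z\<close> be the parts of it coming from words that end, respectively start,
  with \<open>X\<close>; they converge for \<open>z > \<theta>\<close>.  Appending a word letter by letter and recording the change of
  weight at each letter gives linear equations with coefficient matrix \<open>P z\<close>; solving them expresses
  \<open>R_i z\<close> by the words ending in the \<open>i\<close>-th word of the collection, and yields
  \<open>gen z * (z - q + R z) = z\<close> and \<open>z^(p-1) gen_end X z / gen z \<longrightarrow> U_X\<close> as \<open>z\<close> decreases to \<open>\<theta>\<close>.
  Reversing all words turns \<open>P\<close> into \<open>Q\<close>, so \<open>z^(p-1) gen_start X z / gen z \<longrightarrow> V_X\<close>.
  A word ending in \<open>X\<close> glued to a word starting with \<open>X\<close> is a word with a marked window, so the sum of
  \<open>gen_end X z * gen_start X z\<close> over all \<open>X\<close> is \<open>- z^(2-p) gen' z\<close> up to terms that are negligible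
  compared with \<open>(gen z)^2\<close>.  Since \<open>gen z\<close> tends to infinity at \<open>\<theta>\<close>, dividing by \<open>(gen z)^2\<close> gives the
  claim.
\<close>

section \<open>Weights of words\<close>

declare suffix_snoc [simp del]

text \<open>Three obstacles shape the argument. (1) \<open>gen\<close> sums over all words without
  forbidden subwords, while \<open>A\<close> sees only words that extend to infinite sequences. A
  word can run into a dead end only within a bounded number of letters, so both counts grow at the
  rate \<theta>, and a window that is a dead end contributes nothing in the limit. (2) Nothing
  guarantees that det P is nonzero at \<theta>, so \<open>R_i\<close> is not obtained by inverting P
  at that point. Cramer's rule is used to the right of \<theta>, where it gives a bounded ratio of
  generating functions, and a bounded rational function has no pole. Hence all limits are one-sided.
  (3) Words are glued along windows of length \<open>p - 1\<close>; as repeated words have length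
  \<open>p\<close>, such a window has weight 0 or 1 and the weights of the two parts simply
  multiply. The factor \<open>1 + R'\<close> arises by differentiating
  \<open>gen z * (z - q + R z) = z\<close>: this expresses \<open>- z * gen' z\<close> as
  \<open>(1 + R' z) * gen z ^ 2 - gen z\<close>, and only the first term survives the division by
  \<open>gen z ^ 2\<close>. That \<open>gen\<close> diverges at \<theta> comes from an eigenvalue of
  modulus \<theta>, which forces path counts of order \<open>\<theta> ^ n\<close>.\<close>

definition avoids :: "'a list list \<Rightarrow> 'a list \<Rightarrow> bool" where
  "avoids a w \<longleftrightarrow> (\<forall>u\<in>set a. \<not> sublist u w)"

definition weight :: "'a list list \<Rightarrow> 'a list list \<Rightarrow> nat list \<Rightarrow> 'a list \<Rightarrow> real" where
  "weight a r m w = (if avoids a w then real (word_mult r m w) else 0)"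

lemma occurrences_snoc:
  assumes "u \<noteq> []"
  shows "occurrences (w @ [c]) u = occurrences w u + (if suffix u (w @ [c]) then 1 else 0)"
proof -
  let ?S = "\<lambda>w. {k. k + length u \<le> length w \<and> take (length u) (drop k w) = u}"
  let ?T = "{k. k + length u = Suc (length w) \<and> drop k (w @ [c]) = u}"
  have "?S (w @ [c]) = ?S w \<union> ?T"
  proof (intro equalityI subsetI)
    fix k assume k: "k \<in> ?S (w @ [c])"
    show "k \<in> ?S w \<union> ?T"
    proof (cases "k + length u \<le> length w")
      case False
      with k have "k + length u = Suc (length w)" by auto
      with k show ?thesis by (auto simp: take_all)
    qed (use k in auto)
  next
    fix k assume "k \<in> ?S w \<union> ?T"
    then show "k \<in> ?S (w @ [c])" by auto
  qed
  moreover have "?S w \<inter> ?T = {}" by auto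
  moreover have "finite (?S w)" by (rule finite_subset[of _ "{..length w}"]) auto
  moreover have T: "?T = (if suffix u (w @ [c]) then {Suc (length w) - length u} else {})"
    (is "_ = (if _ then {?k} else {})")
  proof (cases "suffix u (w @ [c])")
    case True
    then obtain v where v: "w @ [c] = v @ u" by (auto simp: suffix_def)
    then have "Suc (length w) = length v + length u" by (metis length_append length_append_singleton)
    with v True show ?thesis by auto
  next
    case False
    then have "drop k (w @ [c]) \<noteq> u" for k using suffix_drop[of k "w @ [c]"] by metis
    with False show ?thesis by (simp del: drop_append)
  qed
  ultimately show ?thesis
    unfolding occurrences_def by (simp add: card_Un_disjoint)
qed

text \<open>One inequality is enough, because reversal is an involution. The start of an occurrence
  is mapped to the number of letters that follow the occurrence.\<close>

lemma occurrences_le_rev: "occurrences w u \<le> occurrences (rev w) (rev u)"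
proof -
  let ?S = "\<lambda>w u. {k. k + length u \<le> length w \<and> take (length u) (drop k w) = u}"
  have *: "(\<lambda>k. length w - length u - k) ` ?S w u \<subseteq> ?S (rev w) (rev u)"
  proof (intro subsetI, elim imageE, simp only: mem_Collect_eq)
    fix k' k assume k: "k + length u \<le> length w \<and> take (length u) (drop k w) = u"
    have "length w - (length w - length u - k) = k + length u"
      using k by linarith
    then have "drop (length w - length u - k) (rev w) = rev (take (k + length u) w)"
      by (simp add: drop_rev)
    also have "take (length u) \<dots> = rev (drop k (take (k + length u) w))"
      using k by (simp add: take_rev min_absorb2)
    also have "\<dots> = rev u" using k by (simp add: drop_take)
    finally show "length w - length u - k + length (rev u) \<le> length (rev w) \<and>
      take (length (rev u)) (drop (length w - length u - k) (rev w)) = rev u"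
      using k by simp
  qed
  show ?thesis unfolding occurrences_def
  proof (rule card_inj_on_le[OF _ *])
    show "inj_on (\<lambda>k. length w - length u - k) (?S w u)" by (auto simp: inj_on_def)
    show "finite (?S (rev w) (rev u))" by (rule finite_subset[of _ "{..length w}"]) auto
  qed
qed

lemma occurrences_rev: "occurrences (rev w) (rev u) = occurrences w u"
  using occurrences_le_rev[of w u] occurrences_le_rev[of "rev w" "rev u"] by simp

lemma avoids_rev: "avoids (map rev a) (rev w) \<longleftrightarrow> avoids a w"
  by (auto simp: avoids_def)

lemma weight_rev: "weight (map rev a) (map rev r) m (rev w) = weight a r m w"
  by (simp add: weight_def avoids_rev word_mult_def occurrences_rev)

text \<open>Every assumption is invariant under reversing all words, so the locale can be
  instantiated once more with the reversed collection. The antichain condition concerns repeated and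
  forbidden words together, which makes the word ending at a given letter unique.\<close>

locale weighted_words =
  fixes a r :: "'a::finite list list" and m :: "nat list" and p :: nat
  assumes distinct_words: "distinct (r @ a)"
    and antichain: "u \<in> set (r @ a) \<Longrightarrow> v \<in> set (r @ a) \<Longrightarrow> sublist u v \<Longrightarrow> u = v"
    and length_repeated: "u \<in> set r \<Longrightarrow> length u = p"
    and length_words: "u \<in> set (r @ a) \<Longrightarrow> 2 \<le> length u \<and> length u \<le> p"
    and two_le_p: "2 \<le> p"
    and length_m: "length m = length r"
    and two_le_m: "k \<in> set m \<Longrightarrow> 2 \<le> k"
begin


abbreviation ws :: "'a list list" where "ws \<equiv> r @ a"

abbreviation wt :: "'a list \<Rightarrow> real" where "wt \<equiv> weight a r m"

lemma reverse: "weighted_words (map rev a) (map rev r) m p"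
proof
  show "distinct (map rev r @ map rev a)"
    using distinct_words by (simp add: distinct_map flip: map_append)
  show "u = v" if "u \<in> set (map rev r @ map rev a)" "v \<in> set (map rev r @ map rev a)" "sublist u v"
    for u v
  proof -
    have "rev u = rev v"
      using that by (intro antichain) auto
    then show ?thesis by simp
  qed
  show "length u = p" if "u \<in> set (map rev r)" for u
    using that length_repeated by auto
  show "2 \<le> length u \<and> length u \<le> p" if "u \<in> set (map rev r @ map rev a)" for u
  proof -
    have "rev u \<in> set (r @ a)" using that by auto
    from length_words[OF this] show ?thesis by simp
  qed
qed (use two_le_p length_m two_le_m in auto)

lemma nonempty_words: "u \<in> set ws \<Longrightarrow> u \<noteq> []"
  using length_words by fastforce

text \<open>The multiplier that the last letter of \<open>u\<close> contributes to the weight. Only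
  words of the collection that end there count, so it depends on at most the last \<open>p\<close>
  letters.\<close>

definition factor :: "'a list \<Rightarrow> real" where
  "factor u = (if \<exists>v\<in>set a. suffix v u then 0
     else (\<Prod>i<length r. if suffix (r ! i) u then real (m ! i) else 1))"

lemma avoids_snoc: "avoids a (w @ [c]) \<longleftrightarrow> avoids a w \<and> \<not> (\<exists>v\<in>set a. suffix v (w @ [c]))"
  unfolding avoids_def sublist_snoc by auto

lemma weight_snoc: "wt (w @ [c]) = wt w * factor (w @ [c])"
proof -
  have "real (word_mult r m (w @ [c])) = real (word_mult r m w) *
      (\<Prod>i<length r. if suffix (r ! i) (w @ [c]) then real (m ! i) else 1)"
  proof -
    have "real (m ! i) ^ occurrences (w @ [c]) (r ! i) =
        real (m ! i) ^ occurrences w (r ! i) *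
        (if suffix (r ! i) (w @ [c]) then real (m ! i) else 1)" if "i < length r" for i
    proof -
      have "r ! i \<noteq> []" using that nonempty_words[of "r ! i"] by auto
      then show ?thesis by (simp add: occurrences_snoc)
    qed
    then show ?thesis
      unfolding word_mult_def of_nat_prod of_nat_power prod.distrib[symmetric]
      by (intro prod.cong) auto
  qed
  then show ?thesis unfolding weight_def factor_def avoids_snoc by auto
qed

lemma weight_nonneg [simp]: "0 \<le> wt w"
  by (simp add: weight_def)

lemma factor_nonneg: "0 \<le> factor u"
  by (auto simp: factor_def intro!: prod_nonneg)

lemma word_mult_pos: "0 < word_mult r m w"
proof -
  have "0 < m ! i" if "i < length r" for i
    using two_le_m[of "m ! i"] that length_m by auto
  then show ?thesis by (simp add: word_mult_def prod_pos)
qed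

lemma weight_pos: "0 < wt w \<longleftrightarrow> avoids a w"
  using word_mult_pos[of w] by (auto simp: weight_def)

text \<open>A repeated word has exactly \<open>p\<close> letters and does not fit. Hence a window of
  length \<open>p - 1\<close> has weight 0 or 1, and gluing along it counts no repeated word
  twice.\<close>

lemma weight_short:
  assumes "length w < p"
  shows "wt w = (if avoids a w then 1 else 0)"
proof -
  have "occurrences w (r ! i) = 0" if "i < length r" for i
    using length_repeated[of "r ! i"] that assms by (simp add: occurrences_def)
  then show ?thesis by (simp add: weight_def word_mult_def)
qed

lemma factor_append:
  assumes "p \<le> length u"
  shows "factor (v @ u) = factor u"
proof -
  have "suffix x (v @ u) \<longleftrightarrow> suffix x u" if "x \<in> set ws" for x
    using length_words[OF that] assms
    by (meson le_trans suffix_appendI suffix_length_suffix suffix_order.refl suffixI)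
  moreover have "r ! i \<in> set ws" if "i < length r" for i using that by auto
  ultimately show ?thesis unfolding factor_def
    by (intro if_cong refl prod.cong) auto
qed

text \<open>Every forbidden or repeated word meeting both sides of a window of length \<open>p - 1\<close> would be
  longer than \<open>p\<close>.\<close>

lemma weight_glue:
  assumes "length X = p - 1"
  shows "wt (u @ X) * wt (X @ v) = wt (u @ X @ v)"
proof (induction v rule: rev_induct)
  case Nil
  have "wt X = 0 \<Longrightarrow> wt (u @ X) = 0"
  proof -
    assume "wt X = 0"
    then have "\<not> avoids a X" using weight_pos[of X] by simp
    then have "\<not> avoids a (u @ X)" unfolding avoids_def
      by (meson sublist_append_leftI sublist_order.order.trans)
    then show ?thesis by (simp add: weight_def)
  qed
  then show ?case using weight_short[of X] assms two_le_p by (auto split: if_splits)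
next
  case (snoc c v)
  have "wt (u @ X @ v @ [c]) = wt (u @ X @ v) * factor (u @ X @ v @ [c])"
    using weight_snoc[of "u @ X @ v" c] by simp
  \<comment> \<open>\<open>X @ v @ [c]\<close> has at least \<open>p\<close> letters, so the new
    factor does not see \<open>u\<close>.\<close>
  also have "factor (u @ X @ v @ [c]) = factor (X @ v @ [c])"
    by (rule factor_append) (use assms in simp)
  also have "wt (u @ X @ v) * factor (X @ v @ [c]) = wt (u @ X) * wt (X @ v @ [c])"
    using weight_snoc[of "X @ v" c] snoc by simp
  finally show ?case by simp
qed

text \<open>The loss of weight at the last letter is carried by the unique word of the collection that
  ends there.\<close>

definition loss :: "'a list \<Rightarrow> real" where
  "loss u = wt (butlast u) - wt u"

text \<open>Two suffixes of one word are comparable, and comparable words of the collection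
  coincide.\<close>

lemma suffix_unique:
  assumes "i < length ws" "j < length ws" "suffix (ws ! i) u" "suffix (ws ! j) u"
  shows "i = j"
proof -
  have "suffix (ws ! i) (ws ! j) \<or> suffix (ws ! j) (ws ! i)"
    using assms by (meson suffix_same_cases)
  then have "ws ! i = ws ! j"
    using antichain[of "ws ! i" "ws ! j"] antichain[of "ws ! j" "ws ! i"] assms
    by (metis nth_mem suffix_imp_sublist)
  then show ?thesis using distinct_words assms(1,2) by (simp add: nth_eq_iff_index_eq)
qed

lemma factor_eq_1:
  assumes "\<And>v. v \<in> set ws \<Longrightarrow> \<not> suffix v u"
  shows "factor u = 1"
proof -
  have "\<not> suffix (r ! i) u" if "i < length r" for i using that assms[of "r ! i"] by auto
  then show ?thesis using assms by (auto simp: factor_def)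
qed

text \<open>At most one summand is nonzero, and if no word of the collection ends at
  \<open>c\<close> the factor is 1 and nothing is lost. As a finite sum it can be interchanged with
  the summation over all words.\<close>

lemma loss_decomp: "loss (w @ [c]) =
  (\<Sum>k<length ws. if suffix (ws ! k) (w @ [c]) then loss (w @ [c]) else 0)"
proof (cases "\<exists>k<length ws. suffix (ws ! k) (w @ [c])")
  case True
  then obtain k where k: "k < length ws" "suffix (ws ! k) (w @ [c])" by blast
  have "(\<Sum>j<length ws. if suffix (ws ! j) (w @ [c]) then loss (w @ [c]) else 0)
      = (\<Sum>j<length ws. if j = k then loss (w @ [c]) else 0)"
    by (intro sum.cong refl) (use k suffix_unique in fastforce)
  also have "\<dots> = loss (w @ [c])" using k by (subst sum.delta) auto
  finally show ?thesis by simp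
next
  case False
  then have "\<not> suffix v (w @ [c])" if "v \<in> set ws" for v
    using that by (metis in_set_conv_nth)
  then have "factor (w @ [c]) = 1" by (rule factor_eq_1)
  then have "loss (w @ [c]) = 0" by (simp add: loss_def weight_snoc)
  then show ?thesis by simp
qed

lemma weight_butlast:
  assumes "i < length r" "suffix (r ! i) u"
  shows "wt (butlast u) = wt u / real (m ! i)"
proof -
  have "r ! i \<noteq> []" using assms nonempty_words[of "r ! i"] by auto
  with assms(2) have "u \<noteq> []" by auto
  then obtain w c where u: "u = w @ [c]" by (metis rev_exhaust)
  have i: "i < length ws" "ws ! i = r ! i" using assms by (auto simp: nth_append)
  have "\<not> suffix v u" if "v \<in> set a" for v
  proof
    assume v: "suffix v u"
    from that obtain j where j: "j < length a" "v = a ! j" by (metis in_set_conv_nth)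
    then have "i = length r + j"
      using suffix_unique[of i "length r + j" u] i assms v by simp
    then show False using assms by simp
  qed
  moreover have "suffix (r ! j) u \<longleftrightarrow> j = i" if "j < length r" for j
    using suffix_unique[of i j u] i assms that by (auto simp: nth_append)
  ultimately have "factor u = (\<Prod>j<length r. if j = i then real (m ! j) else 1)"
    unfolding factor_def by (auto intro!: prod.cong)
  also have "\<dots> = real (m ! i)" using assms by (subst prod.delta) auto
  finally have "wt u = wt (butlast u) * real (m ! i)" by (simp add: u weight_snoc)
  moreover have "m ! i \<noteq> 0" using two_le_m[of "m ! i"] assms length_m by auto
  ultimately show ?thesis by simp
qed

text \<open>A repeated word increases the weight, so the loss is negative. This is the origin of the
  coefficients \<open>1 - 1 / m_i\<close>.\<close>

lemma loss_repeated:
  assumes "i < length r" "suffix (r ! i) u"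
  shows "loss u = - (1 - 1 / real (m ! i)) * wt u"
  using weight_butlast[OF assms] by (simp add: loss_def algebra_simps)

lemma weight_forbidden:
  assumes "v \<in> set a" "suffix v u"
  shows "wt u = 0"
  using assms by (auto simp: weight_def avoids_def)

lemma weight_telescope:
  "(\<Sum>t\<in>{1..length v}. loss (w @ take t v)) = wt w - wt (w @ v)"
proof -
  have "(\<Sum>t\<in>{1..n}. loss (w @ take t v)) = wt w - wt (w @ take n v)" if "n \<le> length v" for n
    using that
  proof (induction n)
    case (Suc n)
    then have "butlast (w @ take (Suc n) v) = w @ take n v"
      by (simp add: take_Suc_conv_app_nth butlast_append)
    then have "loss (w @ take (Suc n) v) = wt (w @ take n v) - wt (w @ take (Suc n) v)"
      by (simp only: loss_def)
    moreover have "(\<Sum>t\<in>{1..n}. loss (w @ take t v)) = wt w - wt (w @ take n v)"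
      using Suc by simp
    ultimately show ?case by (simp del: take_Suc)
  qed simp
  from this[of "length v"] show ?thesis by simp
qed

end

section \<open>Generating functions and telescoping\<close>

lemma suffix_iff_drop: "suffix x u \<longleftrightarrow> drop (length u - length x) u = x"
proof
  assume "suffix x u"
  then show "drop (length u - length x) u = x" by (auto simp: suffix_def)
next
  assume "drop (length u - length x) u = x"
  then show "suffix x u" using suffix_drop[of "length u - length x" u] by simp
qed

lemma prefix_iff_take: "prefix x u \<longleftrightarrow> take (length x) u = x"
  by (metis append_eq_conv_conj prefix_def take_is_prefix)

lemma infsum_diff_real:
  fixes f g :: "'b \<Rightarrow> real"
  assumes "f summable_on A" "g summable_on A"
  shows "(\<Sum>\<^sub>\<infinity>x\<in>A. f x - g x) = infsum f A - infsum g A"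
    and "(\<lambda>x. f x - g x) summable_on A"
proof -
  have g: "(\<lambda>x. - g x) summable_on A" using assms(2) by (simp add: summable_on_uminus)
  show "(\<Sum>\<^sub>\<infinity>x\<in>A. f x - g x) = infsum f A - infsum g A"
    using infsum_add[OF assms(1) g] by (simp add: infsum_uminus)
  show "(\<lambda>x. f x - g x) summable_on A"
    using summable_on_add[OF assms(1) g] by simp
qed

lemma infsum_sum_real:
  fixes f :: "'k \<Rightarrow> 'b \<Rightarrow> real"
  assumes "finite T" "\<And>k. k \<in> T \<Longrightarrow> f k summable_on A"
  shows "(\<Sum>\<^sub>\<infinity>x\<in>A. \<Sum>k\<in>T. f k x) = (\<Sum>k\<in>T. infsum (f k) A)"
    and "(\<lambda>x. \<Sum>k\<in>T. f k x) summable_on A"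
  using assms by (induction T) (auto simp: infsum_add summable_on_add)

section \<open>Overlaps of words and correlation polynomials\<close>

definition overlap :: "'a list \<Rightarrow> 'a list \<Rightarrow> real \<Rightarrow> real" where
  "overlap u v z = (\<Sum>t\<in>{1..length v}. if suffix (take t v) u then z ^ t else 0)"

text \<open>Position \<open>i\<close> of the correlation is an overlap of
  \<open>t = length u - i\<close> letters, and the factor \<open>z\<close> makes the exponent equal
  to \<open>t\<close>. The two sides could differ only where \<open>v\<close> lies inside
  \<open>u\<close> with letters of \<open>u\<close> left over to its right: the correlation counts
  such positions, \<open>overlap\<close> does not, and the assumption excludes them.\<close>

lemma overlap_corr_val:
  assumes "\<not> (length v < length u \<and> sublist v u)"
  shows "z * corr_val u v z = overlap u v z"
proof -
  have corr: "corr_at u v (length u - t) \<longleftrightarrow> t \<le> length v \<and> suffix (take t v) u"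
    if t: "1 \<le> t" "t \<le> length u" for t
  proof (cases "t \<le> length v")
    case True
    have "corr_at u v (length u - t) \<longleftrightarrow> drop (length u - t) u = take t v"
      unfolding corr_at_def using t True
      by (subst list_eq_iff_nth_eq) (auto simp: less_diff_conv add.commute)
    also have "\<dots> \<longleftrightarrow> suffix (take t v) u"
      using t True by (simp add: suffix_iff_drop min_absorb2)
    finally show ?thesis using True by simp
  next
    case False
    have "\<not> corr_at u v (length u - t)"
    proof
      assume c: "corr_at u v (length u - t)"
      have "take (length v) (drop (length u - t) u) = v"
        using c t False unfolding corr_at_def by (intro nth_equalityI) auto
      then have "sublist v u"
        by (metis sublist_take sublist_drop sublist_order.order.trans)
      then show False using assms t False by auto
    qed
    then show ?thesis using False by simp
  qed
  have "z * corr_val u v z = (\<Sum>i<length u. if corr_at u v i then z ^ (length u - i) else 0)"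
    unfolding corr_poly_def poly_sum sum_distrib_left
  proof (intro sum.cong refl)
    fix i assume "i \<in> {..<length u}"
    then have "length u - i = Suc (length u - 1 - i)" by auto
    then show "z * poly (if corr_at u v i then monom 1 (length u - 1 - i) else 0) z =
        (if corr_at u v i then z ^ (length u - i) else 0)"
      by (simp add: poly_monom)
  qed
  also have "\<dots> = (\<Sum>i<length u. if length u - i \<le> length v \<and> suffix (take (length u - i) v) u
      then z ^ (length u - i) else 0)"
  proof (intro sum.cong refl if_cong)
    fix i assume "i \<in> {..<length u}"
    then show "corr_at u v i \<longleftrightarrow> length u - i \<le> length v \<and> suffix (take (length u - i) v) u"
      using corr[of "length u - i"] by simp
  qed
  also have "\<dots> = (\<Sum>t\<in>{1..length u}. if t \<le> length v \<and> suffix (take t v) u then z ^ t else 0)"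
    by (rule sum.reindex_bij_witness[of _ "\<lambda>t. length u - t" "\<lambda>i. length u - i"]) auto
  also have "\<dots> = (\<Sum>t\<in>{1..length u} \<inter> {1..length v}. if suffix (take t v) u then z ^ t else 0)"
    by (rule sum.mono_neutral_cong_right) auto
  also have "\<dots> = overlap u v z"
    unfolding overlap_def
  proof (rule sum.mono_neutral_cong_left)
    show "\<forall>t\<in>{1..length v} - {1..length u} \<inter> {1..length v}.
        (if suffix (take t v) u then z ^ t else 0) = 0"
      by (auto dest: suffix_length_le)
  qed auto
  finally show ?thesis .
qed

lemma overlap_rev: "overlap (rev v) (rev u) z = overlap u v z"
proof -
  \<comment> \<open>A suffix of \<open>u\<close> has at most \<open>length u\<close> letters;
    restricting \<open>t\<close> by both lengths makes the index set symmetric in the two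
    words.\<close>
  have aux: "(\<Sum>t\<in>{1..length v}. if suffix (take t v) u then z ^ t else 0) =
    (\<Sum>t | 1 \<le> t \<and> t \<le> length u \<and> t \<le> length v \<and> suffix (take t v) u. z ^ t)"
    for u v :: "'a list"
    by (subst sum.inter_filter[symmetric], simp, intro sum.cong refl)
      (auto dest: suffix_length_le)
  have "suffix (take t (rev u)) (rev v) \<longleftrightarrow> suffix (take t v) u"
    if t: "t \<le> length u" "t \<le> length v" for t
  proof -
    have "suffix (take t (rev u)) (rev v) \<longleftrightarrow> prefix (drop (length u - t) u) v"
      by (simp add: suffix_to_prefix take_rev)
    also have "\<dots> \<longleftrightarrow> take t v = drop (length u - t) u"
      using t by (simp add: prefix_iff_take)
    also have "\<dots> \<longleftrightarrow> suffix (take t v) u"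
      using t by (simp add: suffix_iff_drop min_absorb2 eq_commute)
    finally show ?thesis .
  qed
  then show ?thesis unfolding overlap_def aux by (intro sum.cong) auto
qed

section \<open>Generating functions of weighted words\<close>

context weighted_words
begin

definition summable_at :: "real \<Rightarrow> bool" where
  "summable_at z \<longleftrightarrow> 0 < z \<and> (\<lambda>w. wt w / z ^ length w) summable_on UNIV"

text \<open>An infinite sum that does not converge is 0 by convention, so the values of this and the
  next two functions are meaningful only under \<open>summable_at\<close>.\<close>

definition gen :: "real \<Rightarrow> real" where
  "gen z = (\<Sum>\<^sub>\<infinity>w. wt w / z ^ length w)"

definition gen_end :: "'a list \<Rightarrow> real \<Rightarrow> real" where
  "gen_end v z = (\<Sum>\<^sub>\<infinity>w. wt (w @ v) / z ^ length (w @ v))"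

definition gen_loss :: "'a list \<Rightarrow> real \<Rightarrow> real" where
  "gen_loss v z = (\<Sum>\<^sub>\<infinity>w. loss (w @ v) / z ^ length (w @ v))"

lemma inj_append_left: "inj_on (\<lambda>w. w @ v) A"
  by (simp add: inj_on_def)

lemma summable_end:
  assumes "summable_at z"
  shows "(\<lambda>w. wt (w @ v) / z ^ length (w @ v)) summable_on UNIV"
proof -
  have "(\<lambda>w. wt w / z ^ length w) summable_on range (\<lambda>w. w @ v)"
    using assms by (auto simp: summable_at_def intro: summable_on_subset_banach)
  then show ?thesis
    by (subst (asm) summable_on_reindex) (auto simp: inj_append_left o_def)
qed

lemma summable_loss_butlast:
  assumes "summable_at z" "v \<noteq> []"
  shows "(\<lambda>w. wt (butlast (w @ v)) / z ^ length (w @ v)) summable_on UNIV"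
proof -
  have "(\<lambda>w. wt (w @ butlast v) / z ^ length (w @ butlast v) * (1 / z)) summable_on UNIV"
    by (intro summable_on_cmult_left summable_end assms)
  moreover obtain v' c where "v = v' @ [c]" using assms(2) by (metis rev_exhaust)
  ultimately show ?thesis by (simp add: butlast_append power_add mult.commute)
qed

lemma summable_loss:
  assumes "summable_at z" "v \<noteq> []"
  shows "(\<lambda>w. loss (w @ v) / z ^ length (w @ v)) summable_on UNIV"
  unfolding loss_def diff_divide_distrib
  by (intro infsum_diff_real summable_loss_butlast summable_end assms)

lemma gen_pos:
  assumes "summable_at z"
  shows "0 < gen z"
proof -
  have "avoids a []" using nonempty_words by (auto simp: avoids_def)
  then have "wt [] = 1" using weight_short[of "[]"] two_le_p by simp
  have "(\<Sum>w\<in>{[]}. wt w / z ^ length w) \<le> gen z"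
    unfolding gen_def using assms unfolding summable_at_def
    by (intro finite_sum_le_infsum) auto
  then show ?thesis using \<open>wt [] = 1\<close> by simp
qed

lemma gen_end_nonneg: "summable_at z \<Longrightarrow> 0 \<le> gen_end v z"
  unfolding gen_end_def summable_at_def by (intro infsum_nonneg) simp

lemma gen_end_le:
  assumes "summable_at z"
  shows "gen_end v z \<le> gen z"
proof -
  have "gen_end v z = (\<Sum>\<^sub>\<infinity>w\<in>range (\<lambda>w. w @ v). wt w / z ^ length w)"
    unfolding gen_end_def by (subst infsum_reindex) (auto simp: inj_append_left o_def)
  also have "\<dots> \<le> gen z"
    unfolding gen_def
  proof (rule infsum_mono2)
    show s: "(\<lambda>w. wt w / z ^ length w) summable_on UNIV"
      using assms by (simp add: summable_at_def)
    show "(\<lambda>w. wt w / z ^ length w) summable_on range (\<lambda>w. w @ v)"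
      by (rule summable_on_subset_banach[OF s]) simp
  qed (use assms in \<open>auto simp: summable_at_def\<close>)
  finally show ?thesis .
qed

lemma gen_loss_eq:
  assumes "summable_at z" "v \<noteq> []"
  shows "gen_loss v z = gen_end (butlast v) z / z - gen_end v z"
proof -
  have "gen_loss v z = (\<Sum>\<^sub>\<infinity>w. wt (butlast (w @ v)) / z ^ length (w @ v)) - gen_end v z"
    unfolding gen_loss_def gen_end_def loss_def diff_divide_distrib
    by (intro infsum_diff_real summable_loss_butlast summable_end assms)
  also have "(\<Sum>\<^sub>\<infinity>w. wt (butlast (w @ v)) / z ^ length (w @ v))
     = (\<Sum>\<^sub>\<infinity>w. wt (w @ butlast v) / z ^ length (w @ butlast v) * (1 / z))"
  proof (rule infsum_cong)
    fix w :: "'a list"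
    obtain v' c where "v = v' @ [c]" using assms(2) by (metis rev_exhaust)
    then show "wt (butlast (w @ v)) / z ^ length (w @ v)
        = wt (w @ butlast v) / z ^ length (w @ butlast v) * (1 / z)"
      by (simp add: butlast_append power_add)
  qed
  also have "\<dots> = gen_end (butlast v) z / z"
    unfolding gen_end_def by (simp only: infsum_cmult_left[OF summable_end[OF assms(1)]]) simp
  finally show ?thesis .
qed

text \<open>The quotient \<open>gen_loss v z / gen z\<close> stays bounded as \<open>z\<close>
  approaches a positive limit, even if \<open>gen z\<close> diverges. This rules out a pole of
  \<open>R_i\<close> at the Perron root.\<close>

lemma gen_loss_bound:
  assumes "summable_at z" "v \<noteq> []"
  shows "\<bar>gen_loss v z\<bar> \<le> (1 / z + 1) * gen z"
proof -
  have z: "0 < z" using assms by (simp add: summable_at_def)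
  have "\<bar>gen_loss v z\<bar> \<le> gen_end (butlast v) z / z + gen_end v z"
    unfolding gen_loss_eq[OF assms]
    using gen_end_nonneg[OF assms(1), of v] gen_end_nonneg[OF assms(1), of "butlast v"] z
    by (intro order.trans[OF abs_triangle_ineq4]) simp
  also have "\<dots> \<le> gen z / z + gen z"
    using gen_end_le[OF assms(1)] z by (intro add_mono divide_right_mono) auto
  finally show ?thesis by (simp add: algebra_simps)
qed

lemma gen_loss_repeated:
  assumes "i < length r" "summable_at z"
  shows "gen_loss (r ! i) z = - (1 - 1 / real (m ! i)) * gen_end (r ! i) z"
proof -
  have "gen_loss (r ! i) z = (\<Sum>\<^sub>\<infinity>w. - (1 - 1 / real (m ! i)) * (wt (w @ r ! i) / z ^ length (w @ r ! i)))"
    unfolding gen_loss_def using assms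
    by (intro infsum_cong) (subst loss_repeated[of i], auto simp: suffix_def)
  also have "\<dots> = - (1 - 1 / real (m ! i)) * gen_end (r ! i) z"
    unfolding gen_end_def by (rule infsum_cmult_right[OF summable_end[OF assms(2)]])
  finally show ?thesis .
qed

lemma gen_end_forbidden: "v \<in> set a \<Longrightarrow> gen_end v z = 0"
  unfolding gen_end_def by (subst weight_forbidden[of v]) (auto simp: suffix_def)

text \<open>Sum \<open>loss_decomp\<close> over the words ending in \<open>x\<close>. If such a word
  also ends in \<open>ws ! k\<close>, one of the two is a suffix of the other. A proper suffix
  \<open>ws ! k\<close> of \<open>x\<close> is excluded by the assumption on \<open>x\<close>;
  otherwise the words ending in both are just those ending in \<open>ws ! k\<close>.\<close>

lemma gen_loss_decomp:
  assumes z: "summable_at z" and x: "x \<noteq> []" "\<And>u. u \<in> set ws \<Longrightarrow> suffix u x \<Longrightarrow> x = u"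
  shows "gen_loss x z = (\<Sum>k<length ws. if suffix x (ws ! k) then gen_loss (ws ! k) z else 0)"
proof -
  let ?h = "\<lambda>u. loss u / z ^ length u"
  have range: "{u. suffix v u} = range (\<lambda>w. w @ v)" for v :: "'a list"
    by (auto simp: suffix_def)
  have gl: "gen_loss v z = infsum ?h {u. suffix v u}" for v
    unfolding gen_loss_def range by (subst infsum_reindex) (auto simp: inj_append_left o_def)
  have smb: "?h summable_on {u. suffix x u}"
    using summable_loss[OF z x(1)] unfolding range
    by (subst summable_on_reindex) (auto simp: inj_append_left o_def)
  have "gen_loss x z = (\<Sum>\<^sub>\<infinity>u\<in>{u. suffix x u}. \<Sum>k<length ws. if suffix (ws ! k) u then ?h u else 0)"
    unfolding gl
  proof (rule infsum_cong)
    fix u assume "u \<in> {u. suffix x u}"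
    with x have "u \<noteq> []" by auto
    then obtain w c where u: "u = w @ [c]" by (metis rev_exhaust)
    have "(\<Sum>k<length ws. if suffix (ws ! k) u then ?h u else 0) =
        (\<Sum>k<length ws. if suffix (ws ! k) u then loss u else 0) / z ^ length u"
      unfolding sum_divide_distrib by (intro sum.cong) auto
    also have "\<dots> = ?h u" using loss_decomp[of w c] u by metis
    finally show "?h u = (\<Sum>k<length ws. if suffix (ws ! k) u then ?h u else 0)" by (rule sym)
  qed
  also have "\<dots> = (\<Sum>k<length ws. \<Sum>\<^sub>\<infinity>u\<in>{u. suffix x u}. if suffix (ws ! k) u then ?h u else 0)"
  proof (rule infsum_sum_real(1), simp)
    fix k
    have "?h summable_on {u. suffix x u \<and> suffix (ws ! k) u}"
      by (rule summable_on_subset_banach[OF smb]) auto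
    then show "(\<lambda>u. if suffix (ws ! k) u then ?h u else 0) summable_on {u. suffix x u}"
      by (subst (asm) summable_on_cong_neutral
          [where T = "{u. suffix x u}" and g = "\<lambda>u. if suffix (ws ! k) u then ?h u else 0"]) auto
  qed
  also have "\<dots> = (\<Sum>k<length ws. if suffix x (ws ! k) then gen_loss (ws ! k) z else 0)"
  proof (intro sum.cong refl)
    fix k assume k: "k \<in> {..<length ws}"
    have "(\<Sum>\<^sub>\<infinity>u\<in>{u. suffix x u}. if suffix (ws ! k) u then ?h u else 0)
        = infsum ?h {u. suffix x u \<and> suffix (ws ! k) u}"
      by (rule infsum_cong_neutral) auto
    also have "\<dots> = (if suffix x (ws ! k) then gen_loss (ws ! k) z else 0)"
    proof (cases "suffix x (ws ! k)")
      case True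
      then have "{u. suffix x u \<and> suffix (ws ! k) u} = {u. suffix (ws ! k) u}"
        by (auto intro: suffix_order.trans[OF True])
      then show ?thesis using True by (simp add: gl)
    next
      case False
      have "\<not> (suffix x u \<and> suffix (ws ! k) u)" for u
      proof
        assume "suffix x u \<and> suffix (ws ! k) u"
        then have "suffix (ws ! k) x" using False by (metis suffix_same_cases)
        then have "x = ws ! k" using x(2) k by (meson lessThan_iff nth_mem)
        then show False using False by simp
      qed
      then have "{u. suffix x u \<and> suffix (ws ! k) u} = {}" by blast
      then show ?thesis using False by (simp only: infsum_empty if_False)
    qed
    finally show "(\<Sum>\<^sub>\<infinity>u\<in>{u. suffix x u}. if suffix (ws ! k) u then ?h u else 0) =
      (if suffix x (ws ! k) then gen_loss (ws ! k) z else 0)" .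
  qed
  finally show ?thesis .
qed

text \<open>Appending \<open>v\<close> letter by letter telescopes the loss; the factor
  \<open>z ^ t\<close> offsets the \<open>t\<close> appended letters, and
  \<open>gen_loss_decomp\<close> at each prefix produces the overlaps. By the assumption a word of
  the collection contained in \<open>v\<close> starts at its first letter, which covers words of the
  collection, windows and single letters.\<close>

lemma gen_telescope:
  assumes z: "summable_at z"
    and v: "\<And>u t. u \<in> set ws \<Longrightarrow> suffix u (take t v) \<Longrightarrow> take t v = u"
  shows "gen z - z ^ length v * gen_end v z =
    (\<Sum>k<length ws. gen_loss (ws ! k) z * overlap (ws ! k) v z)"
proof -
  have z0: "0 < z" using z by (simp add: summable_at_def)
  have "gen z - z ^ length v * gen_end v z =
     (\<Sum>\<^sub>\<infinity>w. wt w / z ^ length w) - (\<Sum>\<^sub>\<infinity>w. z ^ length v * (wt (w @ v) / z ^ length (w @ v)))"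
    unfolding gen_def gen_end_def by (simp only: infsum_cmult_right[OF summable_end[OF z]])
  also have "\<dots> = (\<Sum>\<^sub>\<infinity>w. wt w / z ^ length w - z ^ length v * (wt (w @ v) / z ^ length (w @ v)))"
    by (intro infsum_diff_real(1)[symmetric] summable_on_cmult_right summable_end z)
      (use z in \<open>simp add: summable_at_def\<close>)
  also have "\<dots> = (\<Sum>\<^sub>\<infinity>w. \<Sum>t\<in>{1..length v}. z ^ t * (loss (w @ take t v) / z ^ length (w @ take t v)))"
  proof (rule infsum_cong)
    fix w :: "'a list"
    have "wt w / z ^ length w - z ^ length v * (wt (w @ v) / z ^ length (w @ v))
       = (wt w - wt (w @ v)) / z ^ length w"
      using z0 by (simp add: power_add field_simps)
    also have "\<dots> = (\<Sum>t\<in>{1..length v}. loss (w @ take t v) / z ^ length w)"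
      by (simp add: weight_telescope[symmetric] sum_divide_distrib)
    also have "\<dots> = (\<Sum>t\<in>{1..length v}. z ^ t * (loss (w @ take t v) / z ^ length (w @ take t v)))"
      using z0 by (intro sum.cong refl) (simp add: power_add)
    finally show "wt w / z ^ length w - z ^ length v * (wt (w @ v) / z ^ length (w @ v)) = \<dots>" .
  qed
  also have "\<dots> = (\<Sum>t\<in>{1..length v}. \<Sum>\<^sub>\<infinity>w. z ^ t * (loss (w @ take t v) / z ^ length (w @ take t v)))"
    by (intro infsum_sum_real(1) summable_on_cmult_right summable_loss z) auto
  also have "\<dots> = (\<Sum>t\<in>{1..length v}. z ^ t * gen_loss (take t v) z)"
    unfolding gen_loss_def
    by (intro sum.cong refl infsum_cmult_right summable_loss z) auto
  also have "\<dots> = (\<Sum>t\<in>{1..length v}. z ^ t *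
      (\<Sum>k<length ws. if suffix (take t v) (ws ! k) then gen_loss (ws ! k) z else 0))"
    by (intro sum.cong refl arg_cong2[of _ _ _ _ "(*)"] gen_loss_decomp z v) auto
  also have "\<dots> = (\<Sum>k<length ws. gen_loss (ws ! k) z * overlap (ws ! k) v z)"
    unfolding overlap_def sum_distrib_left
    by (subst sum.swap) (intro sum.cong refl, auto)
  finally show ?thesis .
qed

end

section \<open>The linear system and gluing\<close>

context weighted_words
begin

text \<open>\<open>z * kappa i\<close> is the diagonal entry \<open>D_ii\<close>, and the same
  factor multiplies the correlations in column \<open>i\<close> of \<open>P\<close>.\<close>

definition kappa :: "nat \<Rightarrow> real" where
  "kappa i = (if i < length r then 1 - 1 / real (m ! i) else - 1)"

lemma kappa_nonzero: "kappa i \<noteq> 0"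
proof (cases "i < length r")
  case True
  then have "2 \<le> m ! i" using two_le_m[of "m ! i"] length_m by auto
  then show ?thesis using True by (simp add: kappa_def)
qed (simp add: kappa_def)

lemma overlap_words:
  assumes "i < length ws" "j < length ws"
  shows "overlap (ws ! j) (ws ! i) z = z * corr_val (ws ! j) (ws ! i) z"
proof (rule overlap_corr_val[symmetric])
  show "\<not> (length (ws ! i) < length (ws ! j) \<and> sublist (ws ! i) (ws ! j))"
    using antichain[of "ws ! i" "ws ! j"] assms by (metis less_irrefl nth_mem)
qed

lemma poly_P_entry:
  assumes "i < length ws" "j < length ws"
  shows "poly (P_entry a r m i j) z = kappa j * overlap (ws ! j) (ws ! i) z
    - (if i = j \<and> i < length r then z ^ p else 0)"
proof -
  have "length (r ! i) = p" if "i < length r" using that length_repeated by simp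
  then show ?thesis
    unfolding overlap_words[OF assms]
    by (auto simp: P_entry_def Let_def kappa_def nth_append algebra_simps)
qed

lemma words_telescope:
  assumes z: "summable_at z" and i: "i < length ws"
  shows "(\<Sum>k<length ws. gen_loss (ws ! k) z * overlap (ws ! k) (ws ! i) z) =
    gen z - z ^ length (ws ! i) * gen_end (ws ! i) z"
proof (rule gen_telescope[OF z, symmetric])
  fix u t assume u: "u \<in> set ws" "suffix u (take t (ws ! i))"
  then have "sublist u (ws ! i)"
    by (meson sublist_order.order.trans suffix_imp_sublist sublist_take)
  then have "u = ws ! i" using antichain u(1) i nth_mem by blast
  with u(2) show "take t (ws ! i) = u"
    by (metis length_take min.cobounded1 suffix_length_le suffix_order.antisym
        take_all nle_le min_def)
qed

text \<open>Row \<open>i\<close> is \<open>words_telescope\<close> for \<open>ws ! i\<close>. Its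
  surplus term with \<open>gen_end\<close> is absorbed by \<open>- z ^ p\<close> on the diagonal if
  the word is repeated, and is 0 if the word is forbidden. After division by \<open>gen z\<close>
  the right-hand side is the all-one vector, so the solution consists of the row sums of the inverse
  of \<open>P\<close>.\<close>

lemma P_solution:
  assumes z: "summable_at z" and i: "i < length ws"
  shows "(\<Sum>j<length ws. poly (P_entry a r m i j) z * (gen_loss (ws ! j) z / kappa j)) = gen z"
proof -
  let ?d = "\<lambda>j. if i = j \<and> i < length r then z ^ p * (gen_loss (ws ! j) z / kappa j) else 0"
  have "(\<Sum>j<length ws. poly (P_entry a r m i j) z * (gen_loss (ws ! j) z / kappa j)) =
    (\<Sum>j<length ws. gen_loss (ws ! j) z * overlap (ws ! j) (ws ! i) z - ?d j)"
  proof (intro sum.cong refl)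
    fix j assume "j \<in> {..<length ws}"
    then have P: "poly (P_entry a r m i j) z = kappa j * overlap (ws ! j) (ws ! i) z
        - (if i = j \<and> i < length r then z ^ p else 0)"
      by (intro poly_P_entry[OF i]) simp
    show "poly (P_entry a r m i j) z * (gen_loss (ws ! j) z / kappa j) =
        gen_loss (ws ! j) z * overlap (ws ! j) (ws ! i) z - ?d j"
      unfolding P using kappa_nonzero[of j]
      by (cases "i = j \<and> i < length r") (auto simp: field_simps)
  qed
  also have "\<dots> = gen z - z ^ length (ws ! i) * gen_end (ws ! i) z - (\<Sum>j<length ws. ?d j)"
    unfolding sum_subtractf words_telescope[OF assms] ..
  also have "(\<Sum>j<length ws. ?d j) = (\<Sum>j<length ws. if j = i then ?d i else 0)"
    by (intro sum.cong) auto
  also have "\<dots> = ?d i" using i by (subst sum.delta) auto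
  also have "\<dots> = - (z ^ length (ws ! i) * gen_end (ws ! i) z)"
  proof (cases "i < length r")
    case True
    then have "gen_loss (ws ! i) z = - kappa i * gen_end (ws ! i) z"
      using gen_loss_repeated[OF True z] by (simp add: kappa_def nth_append)
    then show ?thesis using True kappa_nonzero[of i] length_repeated[of "r ! i"]
      by (simp add: nth_append)
  next
    case False
    then have "ws ! i \<in> set a" using i by (auto simp: nth_append)
    then show ?thesis using False by (simp add: gen_end_forbidden)
  qed
  finally show ?thesis by simp
qed

lemma no_word_in_window:
  assumes "avoids a X" "length X = p - 1" "u \<in> set ws"
  shows "\<not> sublist u X"
proof
  assume "sublist u X"
  then have "length u \<le> p - 1" using assms(2) sublist_length_le by fastforce
  then have "u \<notin> set r" using length_repeated[of u] two_le_p by auto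
  then show False using assms \<open>sublist u X\<close> by (auto simp: avoids_def)
qed

text \<open>\<open>X\<close> may lie properly inside a word of length \<open>p\<close>, so
  \<open>overlap_corr_val\<close> need not apply to \<open>u\<close> itself; it applies to
  \<open>tl u\<close>, which is not longer than \<open>X\<close>. No overlap is lost, since no
  prefix of \<open>X\<close> equals \<open>u\<close>. Hence the truncated words in the formula for
  \<open>U\<close>.\<close>

lemma window_overlap:
  assumes X: "avoids a X" "length X = p - 1" and u: "u \<in> set ws"
  shows "overlap u X z = z * corr_val (tl u) X z"
proof -
  obtain c u' where cu: "u = c # u'" using nonempty_words u by (meson list.exhaust)
  have "z * corr_val (tl u) X z = overlap (tl u) X z"
    using length_words[OF u] X(2) by (intro overlap_corr_val) auto
  moreover have "suffix (take t X) u \<longleftrightarrow> suffix (take t X) u'" for t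
  proof -
    have "take t X \<noteq> u" using no_word_in_window[OF X u] sublist_take[of t X] by metis
    then show ?thesis by (simp add: cu suffix_Cons)
  qed
  ultimately show ?thesis unfolding overlap_def cu by simp
qed

lemma window_telescope:
  assumes z: "summable_at z" and X: "avoids a X" "length X = p - 1"
  shows "z ^ (p - 1) * gen_end X z =
    gen z - z * (\<Sum>k<length ws. gen_loss (ws ! k) z * corr_val (tl (ws ! k)) X z)"
proof -
  have "gen z - z ^ length X * gen_end X z =
     (\<Sum>k<length ws. gen_loss (ws ! k) z * overlap (ws ! k) X z)"
  proof (rule gen_telescope[OF z])
    fix u t assume "u \<in> set ws" "suffix u (take t X)"
    then have "sublist u X" by (meson sublist_order.order.trans suffix_imp_sublist sublist_take)
    then show "take t X = u" using no_word_in_window[OF X] \<open>u \<in> set ws\<close> by blast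
  qed
  also have "\<dots> = (\<Sum>k<length ws. gen_loss (ws ! k) z * (z * corr_val (tl (ws ! k)) X z))"
    by (intro sum.cong refl arg_cong2[of _ _ _ _ "(*)"] window_overlap X nth_mem) simp
  also have "\<dots> = z * (\<Sum>k<length ws. gen_loss (ws ! k) z * corr_val (tl (ws ! k)) X z)"
    by (simp add: sum_distrib_left mult.left_commute)
  finally show ?thesis using X(2) by simp
qed

lemma gen_letters:
  assumes z: "summable_at z"
  shows "gen z = 1 + (\<Sum>c\<in>UNIV. gen_end [c] z)"
proof -
  let ?h = "\<lambda>w. wt w / z ^ length w"
  have s: "?h summable_on A" for A
    using z by (auto simp: summable_at_def intro: summable_on_subset_banach)
  have ge: "gen_end [c] z = infsum ?h (range (\<lambda>w. w @ [c]))" for c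
    unfolding gen_end_def by (subst infsum_reindex) (auto simp: inj_append_left o_def)
  have 1: "?h [] = 1" using weight_short[of "[]"] two_le_p nonempty_words by (auto simp: avoids_def)
  have "(UNIV :: 'a list set) = insert [] (\<Union>c. range (\<lambda>w. w @ [c]))"
    by (auto simp: set_eq_iff image_iff) (metis rev_exhaust)
  then have "gen z = infsum ?h (insert [] (\<Union>c. range (\<lambda>w. w @ [c])))"
    by (simp add: gen_def)
  also have "\<dots> = ?h [] + infsum ?h (\<Union>c. range (\<lambda>w. w @ [c]))"
    by (subst infsum_insert) (auto intro: s)
  also have "infsum ?h (\<Union>c. range (\<lambda>w. w @ [c])) = (\<Sum>c\<in>UNIV. gen_end [c] z)"
    unfolding ge by (rule sum_infsum[symmetric]) (auto intro: s)
  finally show ?thesis using 1 by simp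
qed

text \<open>Telescope with the one-letter words and sum over the alphabet: each word of the
  collection has exactly one last letter, so each \<open>gen_loss\<close> is counted once. Sorting
  words by their last letter misses the empty word, hence \<open>gen z - 1\<close>.\<close>

lemma gen_total:
  assumes z: "summable_at z"
  shows "real (card (UNIV :: 'a set)) * gen z - z * (gen z - 1) = z * (\<Sum>k<length ws. gen_loss (ws ! k) z)"
proof -
  have "gen z - z * gen_end [c] z =
     (\<Sum>k<length ws. gen_loss (ws ! k) z * (if c = last (ws ! k) then z else 0))" for c
  proof -
    have "gen z - z ^ length [c] * gen_end [c] z =
       (\<Sum>k<length ws. gen_loss (ws ! k) z * overlap (ws ! k) [c] z)"
    proof (rule gen_telescope[OF z])
      fix u t assume u: "u \<in> set ws" "suffix u (take t [c])"
      then have "length u \<le> 1" using suffix_length_le by fastforce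
      then show "take t [c] = u" using length_words[OF u(1)] by simp
    qed
    also have "\<dots> = (\<Sum>k<length ws. gen_loss (ws ! k) z * (if c = last (ws ! k) then z else 0))"
    proof (intro sum.cong refl arg_cong2[of _ _ _ _ "(*)"])
      fix k assume k: "k \<in> {..<length ws}"
      have "ws ! k \<noteq> []" using k by (intro nonempty_words nth_mem) simp
      then have "suffix [c] (ws ! k) \<longleftrightarrow> c = last (ws ! k)"
        by (metis append_butlast_last_id last_snoc suffix_def)
      moreover have "overlap (ws ! k) [c] z =
          (\<Sum>t\<in>{1}. if suffix (take t [c]) (ws ! k) then z ^ t else 0)"
        unfolding overlap_def by (rule sum.cong) auto
      ultimately show "overlap (ws ! k) [c] z = (if c = last (ws ! k) then z else 0)"
        by (simp only: sum.insert sum.empty finite.emptyI) simp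
    qed
    finally show ?thesis by simp
  qed
  then have "(\<Sum>c\<in>UNIV. gen z - z * gen_end [c] z) =
     (\<Sum>c\<in>UNIV. \<Sum>k<length ws. gen_loss (ws ! k) z * (if c = last (ws ! k) then z else 0))"
    by simp
  also have "\<dots> = (\<Sum>k<length ws. gen_loss (ws ! k) z * z)"
    by (subst sum.swap) (simp add: sum_distrib_left[symmetric])
  finally show ?thesis
    using gen_letters[OF z]
    by (simp add: sum_subtractf sum_distrib_left[symmetric] sum_distrib_right[symmetric] mult.commute)
qed

section \<open>Generating functions under reversal of words\<close>

definition gen_start :: "'a list \<Rightarrow> real \<Rightarrow> real" where
  "gen_start v z = (\<Sum>\<^sub>\<infinity>w. wt (v @ w) / z ^ length (v @ w))"

lemma reverse_summable: "weighted_words.summable_at (map rev a) (map rev r) m z \<longleftrightarrow> summable_at z"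
  and reverse_gen: "weighted_words.gen (map rev a) (map rev r) m z = gen z"
  and reverse_gen_end: "weighted_words.gen_end (map rev a) (map rev r) m (rev v) z = gen_start v z"
proof -
  interpret R: weighted_words "map rev a" "map rev r" m p by (rule reverse)
  have bij: "bij (rev :: 'a list \<Rightarrow> _)" by (rule involuntory_imp_bij) simp
  show "R.summable_at z \<longleftrightarrow> summable_at z"
    unfolding R.summable_at_def summable_at_def
    by (subst summable_on_reindex_bij_betw[OF bij, symmetric]) (simp add: weight_rev)
  show "R.gen z = gen z"
    unfolding R.gen_def gen_def
    by (subst infsum_reindex_bij_betw[OF bij, symmetric]) (simp add: weight_rev)
  show "R.gen_end (rev v) z = gen_start v z"
    unfolding R.gen_end_def gen_start_def
    by (subst infsum_reindex_bij_betw[OF bij, symmetric])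
      (simp add: weight_rev add.commute flip: rev_append)
qed

lemma gen_start_nonneg: "summable_at z \<Longrightarrow> 0 \<le> gen_start v z"
  unfolding gen_start_def summable_at_def by (intro infsum_nonneg) simp

lemma summable_start:
  assumes "summable_at z"
  shows "(\<lambda>w. wt (v @ w) / z ^ length (v @ w)) summable_on UNIV"
proof -
  have "(\<lambda>w. wt w / z ^ length w) summable_on range (\<lambda>w. v @ w)"
    using assms by (auto simp: summable_at_def intro: summable_on_subset_banach)
  then show ?thesis
    by (subst (asm) summable_on_reindex) (auto simp: inj_on_def o_def)
qed

section \<open>Gluing words along a window\<close>

lemma finite_words: "finite {w :: 'a list. length w = n}"
  using finite_lists_length_eq[of "UNIV :: 'a set" n] by simp

text \<open>A triple \<open>(X, u, v)\<close> corresponds to the word \<open>u @ X @ v\<close> with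
  the marked position \<open>length u\<close>. A word of length \<open>n\<close> has
  \<open>n + 1 - d\<close> such positions, and the truncated subtraction gives 0 for words too short
  to contain a window.\<close>

lemma gen_glue:
  assumes z: "summable_at z"
  defines "d \<equiv> p - 1"
  shows "((\<lambda>w. real (Suc (length w) - d) * (wt w / z ^ length w)) has_sum
     z ^ d * (\<Sum>X | length X = d. gen_end X z * gen_start X z)) UNIV"
proof -
  have z0: "0 < z" using z by (simp add: summable_at_def)
  define f where "f = (\<lambda>X u. wt (u @ X) / z ^ length (u @ X))"
  \<comment> \<open>The letters of \<open>X\<close> are counted in both generating functions;
    \<open>z ^ d\<close> cancels one of the two counts.\<close>
  define g where "g = (\<lambda>X v. z ^ d * (wt (X @ v) / z ^ length (X @ v)))"
  let ?N = "{X :: 'a list. length X = d}"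
  have f: "(f X has_sum gen_end X z) UNIV" for X
    unfolding f_def gen_end_def by (intro has_sum_infsum summable_end z)
  have g: "(g X has_sum z ^ d * gen_start X z) UNIV" for X
    unfolding g_def gen_start_def by (intro has_sum_cmult_right has_sum_infsum summable_start z)
  have nonneg: "0 \<le> f X u" "0 \<le> g X u" for X u using z0 by (auto simp: f_def g_def)
  have pair: "((\<lambda>(u, v). f X u * g X v) has_sum gen_end X z * (z ^ d * gen_start X z)) (UNIV \<times> UNIV)"
    for X
  proof (rule has_sum_SigmaI)
    show "((\<lambda>v. case (u, v) of (u, v) \<Rightarrow> f X u * g X v) has_sum f X u * (z ^ d * gen_start X z)) UNIV" for u
      using has_sum_cmult_right[OF g] by simp
    show 2: "((\<lambda>u. f X u * (z ^ d * gen_start X z)) has_sum gen_end X z * (z ^ d * gen_start X z)) UNIV"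
      using has_sum_cmult_left[OF f] by simp
    show "(\<lambda>(u, v). f X u * g X v) summable_on (UNIV \<times> UNIV)"
      by (rule summable_on_SigmaI[where g = "\<lambda>u. f X u * (z ^ d * gen_start X z)"])
        (use has_sum_cmult_right[OF g] 2 nonneg in \<open>auto intro: has_sum_imp_summable\<close>)
  qed
  have "((\<lambda>(X, u, v). f X u * g X v) has_sum
      (\<Sum>X\<in>?N. gen_end X z * (z ^ d * gen_start X z))) (Sigma ?N (\<lambda>_. UNIV \<times> UNIV))"
  proof (rule has_sum_SigmaI)
    show "((\<lambda>y. case (X, y) of (X, u, v) \<Rightarrow> f X u * g X v) has_sum
        gen_end X z * (z ^ d * gen_start X z)) (UNIV \<times> UNIV)" for X
      using pair[of X] by simp
    show 2: "((\<lambda>X. gen_end X z * (z ^ d * gen_start X z)) has_sum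
        (\<Sum>X\<in>?N. gen_end X z * (z ^ d * gen_start X z))) ?N"
      by (intro has_sum_finite finite_words)
    show "(\<lambda>(X, u, v). f X u * g X v) summable_on Sigma ?N (\<lambda>_. UNIV \<times> UNIV)"
      by (rule summable_on_SigmaI[where g = "\<lambda>X. gen_end X z * (z ^ d * gen_start X z)"])
        (use pair 2 nonneg in \<open>auto intro: has_sum_imp_summable\<close>)
  qed
  also have "?this \<longleftrightarrow> ((\<lambda>(w, i). wt w / z ^ length w) has_sum
      z ^ d * (\<Sum>X\<in>?N. gen_end X z * gen_start X z)) (SIGMA w:UNIV. {i. i + d \<le> length w})"
  proof (rule has_sum_reindex_bij_witness)
    show "(\<Sum>X\<in>?N. gen_end X z * (z ^ d * gen_start X z)) =
        z ^ d * (\<Sum>X\<in>?N. gen_end X z * gen_start X z)"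
      by (simp add: sum_distrib_left mult_ac)
    let ?j = "\<lambda>(X, u, v). (u @ X @ v, length u)"
    let ?i = "\<lambda>(w, i). (take d (drop i w), take i w, drop (i + d) w)"
    fix q :: "'a list \<times> 'a list \<times> 'a list" assume q: "q \<in> ?N \<times> UNIV \<times> UNIV"
    then obtain X u v where quv: "q = (X, u, v)" "length X = d" by auto
    show "?i (?j q) = q" using quv by simp
    show "?j q \<in> (SIGMA w:UNIV. {i. i + d \<le> length w})" using quv by simp
    show "(case ?j q of (w, i) \<Rightarrow> wt w / z ^ length w) = (case q of (X, u, v) \<Rightarrow> f X u * g X v)"
      using weight_glue[of X u v] quv z0
      by (simp add: f_def g_def d_def power_add field_simps)
  next
    let ?j = "\<lambda>(X, u, v). (u @ X @ v, length u)"
    let ?i = "\<lambda>(w, i). (take d (drop i w), take i w, drop (i + d) w)"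
    fix q :: "'a list \<times> nat" assume q: "q \<in> (SIGMA w:UNIV. {i. i + d \<le> length w})"
    then obtain w i where wi: "q = (w, i)" "i + d \<le> length w" by auto
    have "take d (drop i w) @ drop (i + d) w = drop i w"
      by (metis append_take_drop_id drop_drop add.commute)
    then show "?j (?i q) = q" using wi by simp
    show "?i q \<in> ?N \<times> UNIV \<times> UNIV" using wi by simp
  qed
  finally have "((\<lambda>(w, i). wt w / z ^ length w) has_sum
      z ^ d * (\<Sum>X\<in>?N. gen_end X z * gen_start X z)) (SIGMA w:UNIV. {i. i + d \<le> length w})" .
  then show ?thesis
  proof (rule has_sum_SigmaD)
    fix w :: "'a list"
    have "{i. i + d \<le> length w} = {..<Suc (length w) - d}" by auto
    then show "((\<lambda>i. case (w, i) of (w, i) \<Rightarrow> wt w / z ^ length w) has_sum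
        real (Suc (length w) - d) * (wt w / z ^ length w)) {i. i + d \<le> length w}"
      by (intro has_sum_finiteI) auto
  qed
qed

section \<open>Grouping words by length: power series in 1/z\<close>

definition weight_count :: "nat \<Rightarrow> real" where
  "weight_count n = (\<Sum>w | length w = n. wt w)"

lemma weight_count_nonneg [simp]: "0 \<le> weight_count n"
  by (simp add: weight_count_def sum_nonneg)

lemma sums_by_length:
  assumes "((\<lambda>w. h (length w) * (wt w / z ^ length w)) has_sum s) UNIV"
  shows "(\<lambda>n. h n * weight_count n * (1 / z) ^ n) sums s"
proof -
  have "((\<lambda>(n, w). h n * (wt w / z ^ n)) has_sum s) (SIGMA n:UNIV. {w :: 'a list. length w = n})"
    using assms
    by (subst has_sum_reindex_bij_witness[where j = snd and i = "\<lambda>w. (length w, w)"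
          and T = UNIV and h = "\<lambda>w. h (length w) * (wt w / z ^ length w)" and s' = s]) auto
  then have "((\<lambda>n. h n * weight_count n * (1 / z) ^ n) has_sum s) UNIV"
  proof (rule has_sum_SigmaD)
    fix n
    show "((\<lambda>w. case (n, w) of (n, w) \<Rightarrow> h n * (wt w / z ^ n)) has_sum
        h n * weight_count n * (1 / z) ^ n) {w :: 'a list. length w = n}"
      by (intro has_sum_finiteI finite_words)
        (simp add: weight_count_def sum_distrib_left sum_divide_distrib power_one_over)
  qed
  then show ?thesis by (rule has_sum_imp_sums)
qed

lemma gen_sums: "summable_at z \<Longrightarrow> (\<lambda>n. weight_count n * (1 / z) ^ n) sums gen z"
  using sums_by_length[of "\<lambda>_. 1" z "gen z"] by (simp add: summable_at_def gen_def has_sum_infsum)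

lemma summable_atI:
  assumes "0 < z" "summable (\<lambda>n. weight_count n * (1 / z) ^ n)"
  shows "summable_at z"
proof -
  have "(\<lambda>(n, w). wt w / z ^ n) summable_on (SIGMA n:UNIV. {w :: 'a list. length w = n})"
  proof (rule summable_on_SigmaI)
    fix n
    show "((\<lambda>w. case (n, w) of (n, w) \<Rightarrow> wt w / z ^ n) has_sum weight_count n * (1 / z) ^ n)
        {w :: 'a list. length w = n}"
      by (intro has_sum_finiteI finite_words)
        (simp add: weight_count_def sum_distrib_right sum_divide_distrib power_one_over)
    show "(\<lambda>n. weight_count n * (1 / z) ^ n) summable_on UNIV"
      using assms by (intro summable_nonneg_imp_summable_on) auto
  qed (use assms in auto)
  then have "(\<lambda>w. wt w / z ^ length w) summable_on UNIV"
    by (subst summable_on_reindex_bij_witness[where i = snd and j = "\<lambda>w. (length w, w)"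
          and T = "SIGMA n:UNIV. {w :: 'a list. length w = n}" and h = "\<lambda>(n, w). wt w / z ^ n"]) auto
  then show ?thesis using assms(1) by (simp add: summable_at_def)
qed

end

section \<open>The matrices over the rational functions\<close>

lemma inv_mat_eq:
  assumes A: "A \<in> carrier_mat n n" and B: "B \<in> carrier_mat n n"
    and AB: "A * B = 1\<^sub>m n" and BA: "B * A = 1\<^sub>m n"
  shows "inv_mat A = B"
proof (cases "mat_inverse A")
  case None
  have "A \<in> Units (ring_mat TYPE(ratfun) n ())"
    unfolding Units_def using assms by (auto simp: ring_mat_simps)
  with mat_inverse(1)[OF A None, of "()"] show ?thesis by simp
next
  case (Some C)
  then have C: "A * C = 1\<^sub>m n" "C \<in> carrier_mat n n" using mat_inverse(2)[OF A Some] by auto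
  have "B = B * (A * C)" using B C by simp
  also have "\<dots> = (B * A) * C" using A B C by (simp add: assoc_mult_mat)
  also have "\<dots> = C" using BA C by simp
  finally show ?thesis using Some by (simp add: inv_mat_def)
qed

lemma eventually_poly_nonzero:
  fixes f :: "real poly"
  assumes "f \<noteq> 0"
  shows "\<forall>\<^sub>F z in at_right t. poly f z \<noteq> 0"
proof -
  let ?X = "{z. poly f z = 0} - {t}"
  have "closed ?X" using poly_roots_finite[OF assms] by (intro finite_imp_closed) simp
  then have "open (- ?X)" by (rule open_Compl)
  then have "\<forall>\<^sub>F z in nhds t. z \<in> - ?X" by (intro eventually_nhds_in_open) auto
  then show ?thesis unfolding eventually_at_filter by eventually_elim auto
qed

text \<open>If the denominator vanishes at \<open>t\<close>, the bound makes the numerator vanish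
  too; both are divisible by \<open>z - t\<close>, and the bound survives the cancellation.
  Induction on the degree ends at a denominator that is nonzero at \<open>t\<close>.\<close>

lemma Fract_removable:
  fixes f g :: "real poly"
  assumes "g \<noteq> 0" and "\<forall>\<^sub>F z in at_right t. \<bar>poly f z\<bar> \<le> B * \<bar>poly g z\<bar>"
  shows "\<exists>f' g'. Fraction_Field.Fract f g = Fraction_Field.Fract f' g' \<and> poly g' t \<noteq> 0"
  using assms
proof (induction "degree g" arbitrary: f g rule: less_induct)
  case less
  show ?case
  proof (cases "poly g t = 0")
    case True
    have "((\<lambda>z. \<bar>poly f z\<bar>) \<longlongrightarrow> \<bar>poly f t\<bar>) (at_right t)"
      "((\<lambda>z. B * \<bar>poly g z\<bar>) \<longlongrightarrow> B * \<bar>poly g t\<bar>) (at_right t)"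
      by (intro tendsto_intros)+
    then have "\<bar>poly f t\<bar> \<le> B * \<bar>poly g t\<bar>"
      using less.prems(2) by (intro tendsto_le[OF trivial_limit_at_right_real])
    then have "poly f t = 0" using True by simp
    then obtain f1 g1 where fg: "f = [:- t, 1:] * f1" "g = [:- t, 1:] * g1"
      using True by (metis poly_eq_0_iff_dvd dvd_def)
    then have g1: "g1 \<noteq> 0" using less.prems(1) by auto
    have "degree g = Suc (degree g1)" unfolding fg(2) using g1 by (subst degree_mult_eq) auto
    moreover have "\<forall>\<^sub>F z in at_right t. \<bar>poly f1 z\<bar> \<le> B * \<bar>poly g1 z\<bar>"
      using less.prems(2) eventually_at_right_less[of t]
    proof eventually_elim
      case (elim z)
      have "\<bar>poly f z\<bar> = (z - t) * \<bar>poly f1 z\<bar>" "\<bar>poly g z\<bar> = (z - t) * \<bar>poly g1 z\<bar>"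
      proof -
        have "\<bar>poly [:- t, 1:] z\<bar> = z - t" using elim(2) by simp
        then show "\<bar>poly f z\<bar> = (z - t) * \<bar>poly f1 z\<bar>" "\<bar>poly g z\<bar> = (z - t) * \<bar>poly g1 z\<bar>"
          by (simp_all only: fg poly_mult abs_mult)
      qed
      with elim have "(z - t) * \<bar>poly f1 z\<bar> \<le> (z - t) * (B * \<bar>poly g1 z\<bar>)"
        by (simp add: mult.left_commute)
      then show ?case using elim(2) by simp
    qed
    ultimately obtain f' g' where "Fraction_Field.Fract f1 g1 = Fraction_Field.Fract f' g'" "poly g' t \<noteq> 0"
      using less.hyps[of g1 f1] g1 by auto
    moreover have "Fraction_Field.Fract f g = Fraction_Field.Fract f1 g1"
    proof -
      have "f * g1 = f1 * g" by (simp only: fg mult_ac)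
      then show ?thesis using less.prems(1) g1 by (subst eq_fract(1)) auto
    qed
    ultimately show ?thesis by auto
  qed blast
qed

lemma coeff_corr_poly:
  "coeff (corr_poly u v) k = (if k < length u \<and> corr_at u v (length u - 1 - k) then 1 else 0)"
proof -
  have "coeff (corr_poly u v) k =
    (\<Sum>i<length u. if i = length u - 1 - k \<and> k < length u then
      (if corr_at u v (length u - 1 - k) then 1 else 0) else 0)"
    unfolding corr_poly_def coeff_sum by (intro sum.cong) (auto simp: coeff_monom)
  also have "\<dots> = (if k < length u \<and> corr_at u v (length u - 1 - k) then 1 else 0)"
    by (cases "k < length u") (auto simp: sum.delta)
  finally show ?thesis .
qed

lemma corr_at_sublist:
  assumes "corr_at u v i" "i + length v \<le> length u"
  shows "sublist v u"
proof -
  have "take (length v) (drop i u) = v"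
    using assms unfolding corr_at_def by (intro nth_equalityI) auto
  then show ?thesis by (metis sublist_take sublist_drop sublist_order.order.trans)
qed

section \<open>Determinant and adjugate of P\<close>

context weighted_words
begin

definition P_poly :: "real poly mat" where
  "P_poly = mat (length ws) (length ws) (\<lambda>(i, j). P_entry a r m i j)"

lemma P_poly_carrier: "P_poly \<in> carrier_mat (length ws) (length ws)"
  by (simp add: P_poly_def)

lemma P_mat_eq: "P_mat a r m = map_mat to_fract P_poly"
  by (rule eq_matI) (auto simp: P_mat_def P_poly_def)

lemma P_entry_kappa:
  assumes "i < length ws" "j < length ws"
  shows "P_entry a r m i j = [:0, kappa j:] * corr_poly (ws ! j) (ws ! i)
    - (if i = j \<and> i < length r then monom 1 p else 0)"
proof -
  have "length (r ! i) = p" if "i < length r" using that length_repeated by simp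
  then show ?thesis using assms
    by (auto simp: P_entry_def Let_def kappa_def nth_append monom_altdef algebra_simps)
qed

text \<open>A term of degree at least \<open>length (ws ! i)\<close> would come from an overlap that
  covers \<open>ws ! i\<close> completely, placing it inside \<open>ws ! j\<close> against the
  antichain condition.\<close>

lemma degree_P_off_diagonal:
  assumes "i < length ws" "j < length ws" "i \<noteq> j"
  shows "degree (P_entry a r m i j) < length (ws ! i)"
proof -
  have ne: "ws ! j \<noteq> ws ! i" using assms distinct_words by (simp add: nth_eq_iff_index_eq)
  have len: "2 \<le> length (ws ! i)" using length_words nth_mem[OF assms(1)] by blast
  have "degree (corr_poly (ws ! j) (ws ! i)) \<le> length (ws ! i) - 2"
  proof (rule degree_le, intro allI impI)
    fix k assume k: "length (ws ! i) - 2 < k"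
    have "\<not> corr_at (ws ! j) (ws ! i) (length (ws ! j) - 1 - k)" if "k < length (ws ! j)"
    proof
      assume "corr_at (ws ! j) (ws ! i) (length (ws ! j) - 1 - k)"
      then have "sublist (ws ! i) (ws ! j)" using k that len by (intro corr_at_sublist) auto
      then show False using antichain[of "ws ! i" "ws ! j"] ne assms nth_mem by metis
    qed
    then show "coeff (corr_poly (ws ! j) (ws ! i)) k = 0" by (simp add: coeff_corr_poly)
  qed
  then have "degree ([:0, kappa j:] * corr_poly (ws ! j) (ws ! i)) \<le> length (ws ! i) - 1"
    using len degree_mult_le[of "[:0, kappa j:]" "corr_poly (ws ! j) (ws ! i)"]
    by (simp add: kappa_nonzero)
  then show ?thesis using len assms by (simp add: P_entry_kappa)
qed

text \<open>The top degree is the overlap of the word with all of itself, with coefficient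
  \<open>kappa i\<close>. Subtracting the diagonal term \<open>z ^ p\<close> leaves
  \<open>- 1 / m_i\<close> for a repeated word; a forbidden word keeps -1.\<close>

lemma degree_P_diagonal:
  assumes i: "i < length ws"
  shows "degree (P_entry a r m i i) = length (ws ! i)"
    and "coeff (P_entry a r m i i) (length (ws ! i)) \<noteq> 0"
proof -
  have len: "2 \<le> length (ws ! i)" using length_words nth_mem[OF i] by blast
  have p: "length (ws ! i) = p" if "i < length r" using that length_repeated by (simp add: nth_append)
  have coeff: "coeff (P_entry a r m i i) k = (case k of 0 \<Rightarrow> 0 | Suc k' \<Rightarrow>
      kappa i * coeff (corr_poly (ws ! i) (ws ! i)) k') - (if i < length r \<and> k = p then 1 else 0)" for k
    using i by (auto simp: P_entry_kappa coeff_pCons split: nat.split)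
  have "corr_at (ws ! i) (ws ! i) 0" by (simp add: corr_at_def)
  moreover obtain n where n: "length (ws ! i) = Suc n" using len by (cases "length (ws ! i)") auto
  ultimately have "coeff (P_entry a r m i i) (length (ws ! i)) = kappa i - (if i < length r then 1 else 0)"
    using p unfolding coeff n by (simp add: coeff_corr_poly n)
  also have "\<dots> \<noteq> 0"
  proof (cases "i < length r")
    case True
    then have "2 \<le> m ! i" using two_le_m[of "m ! i"] length_m by auto
    then show ?thesis using True by (simp add: kappa_def)
  qed (simp add: kappa_def)
  finally show lead: "coeff (P_entry a r m i i) (length (ws ! i)) \<noteq> 0" .
  have "degree (P_entry a r m i i) \<le> length (ws ! i)"
    by (rule degree_le) (use p in \<open>auto simp: coeff coeff_corr_poly split: nat.split\<close>)
  then show "degree (P_entry a r m i i) = length (ws ! i)"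
    using le_degree[OF lead] by simp
qed

text \<open>In each row of \<open>P\<close> the diagonal entry has strictly the largest degree, so the entry of largest
  degree of a kernel vector cannot cancel.\<close>

lemma det_P_poly: "det P_poly \<noteq> 0"
proof
  assume "det P_poly = 0"
  then obtain v where v: "v \<in> carrier_vec (length ws)" "v \<noteq> 0\<^sub>v (length ws)"
    and Pv: "P_poly *\<^sub>v v = 0\<^sub>v (length ws)"
    using det_0_iff_vec_prod_zero[OF P_poly_carrier] by blast
  define I where "I = {i. i < length ws \<and> v $ i \<noteq> 0}"
  have "I \<noteq> {}" using v by (auto simp: I_def vec_eq_iff)
  moreover have "finite I" by (simp add: I_def)
  ultimately have "Max ((\<lambda>j. degree (v $ j)) ` I) \<in> (\<lambda>j. degree (v $ j)) ` I"
    by (intro Max_in) auto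
  then obtain i where i: "i \<in> I" and "degree (v $ i) = Max ((\<lambda>j. degree (v $ j)) ` I)" by auto
  then have max: "degree (v $ j) \<le> degree (v $ i)" if "j \<in> I" for j
    using that \<open>finite I\<close> by simp
  have il: "i < length ws" "v $ i \<noteq> 0" using i by (auto simp: I_def)
  let ?D = "length (ws ! i) + degree (v $ i)"
  have "0 = (P_poly *\<^sub>v v) $ i" using Pv il by simp
  also have "\<dots> = (\<Sum>j<length ws. P_entry a r m i j * v $ j)"
    using v il by (auto simp: P_poly_def scalar_prod_def lessThan_atLeast0 intro!: sum.cong)
  finally have "0 = coeff (\<Sum>j<length ws. P_entry a r m i j * v $ j) ?D" by simp
  also have "\<dots> = (\<Sum>j<length ws. if j = i then coeff (P_entry a r m i i * v $ i) ?D else 0)"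
    unfolding coeff_sum
  proof (intro sum.cong refl)
    fix j assume j: "j \<in> {..<length ws}"
    show "coeff (P_entry a r m i j * v $ j) ?D = (if j = i then coeff (P_entry a r m i i * v $ i) ?D else 0)"
    proof (cases "j = i \<or> v $ j = 0")
      case False
      then have "degree (v $ j) \<le> degree (v $ i)" using j max by (simp add: I_def)
      moreover have "degree (P_entry a r m i j) < length (ws ! i)"
        using j il False by (intro degree_P_off_diagonal) auto
      ultimately have "degree (P_entry a r m i j * v $ j) < ?D"
        using degree_mult_le[of "P_entry a r m i j" "v $ j"] by linarith
      then show ?thesis using False by (simp add: coeff_eq_0)
    qed auto
  qed
  also have "\<dots> = coeff (P_entry a r m i i * v $ i) ?D" using il by (simp add: sum.delta)
  also have "\<dots> = coeff (P_entry a r m i i) (length (ws ! i)) * lead_coeff (v $ i)"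
    using coeff_mult_degree_sum[of "P_entry a r m i i" "v $ i"] degree_P_diagonal[OF il(1)] by simp
  finally show False using degree_P_diagonal[OF il(1)] il by simp
qed

text \<open>\<open>adj_mat\<close> is the adjugate, unrelated to the adjacency entries
  \<open>adj\<close>; divided by \<open>det P_poly\<close> this sum is the rational function
  \<open>R_i\<close>.\<close>

definition R_num :: "nat \<Rightarrow> real poly" where
  "R_num i = (\<Sum>j<length ws. adj_mat P_poly $$ (i, j))"

lemma row_sum_inv_P:
  assumes "i < length ws"
  shows "row_sum (inv_mat (P_mat a r m)) i = Fraction_Field.Fract (R_num i) (det P_poly)"
proof -
  let ?n = "length ws"
  interpret h: inj_comm_ring_hom "to_fract :: real poly \<Rightarrow> ratfun" by (unfold_locales) auto
  note C = P_poly_carrier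
  note A = adj_mat[OF C]
  define d where "d = to_fract (det P_poly)"
  have d: "d \<noteq> 0" using det_P_poly by (simp add: d_def)
  define B where "B = inverse d \<cdot>\<^sub>m map_mat to_fract (adj_mat P_poly)"
  have B: "B \<in> carrier_mat ?n ?n" using A(1) by (simp add: B_def)
  have P: "P_mat a r m \<in> carrier_mat ?n ?n" using C by (simp add: P_mat_eq)
  have one: "map_mat to_fract (det P_poly \<cdot>\<^sub>m 1\<^sub>m ?n) = d \<cdot>\<^sub>m 1\<^sub>m ?n"
    by (rule eq_matI) (auto simp: d_def)
  have smult: "inverse d \<cdot>\<^sub>m (d \<cdot>\<^sub>m 1\<^sub>m ?n) = 1\<^sub>m ?n"
    by (rule eq_matI) (use d in auto)
  have "P_mat a r m * B = inverse d \<cdot>\<^sub>m (map_mat to_fract P_poly * map_mat to_fract (adj_mat P_poly))"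
    unfolding B_def P_mat_eq using A(1) C by (intro mult_smult_distrib) auto
  also have "map_mat to_fract P_poly * map_mat to_fract (adj_mat P_poly) = d \<cdot>\<^sub>m 1\<^sub>m ?n"
    unfolding h.mat_hom_mult[OF C A(1), symmetric] A(2) one ..
  finally have PB: "P_mat a r m * B = 1\<^sub>m ?n" using smult by simp
  have "B * P_mat a r m = inverse d \<cdot>\<^sub>m (map_mat to_fract (adj_mat P_poly) * map_mat to_fract P_poly)"
    unfolding B_def P_mat_eq using A(1) C by (intro mult_smult_assoc_mat) auto
  also have "map_mat to_fract (adj_mat P_poly) * map_mat to_fract P_poly = d \<cdot>\<^sub>m 1\<^sub>m ?n"
    unfolding h.mat_hom_mult[OF A(1) C, symmetric] A(3) one ..
  finally have BP: "B * P_mat a r m = 1\<^sub>m ?n" using smult by simp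
  have "inv_mat (P_mat a r m) = B" by (rule inv_mat_eq[OF P B PB BP])
  then have "row_sum (inv_mat (P_mat a r m)) i = (\<Sum>j<?n. inverse d * to_fract (adj_mat P_poly $$ (i, j)))"
    using A(1) assms B by (auto simp: row_sum_def B_def intro!: sum.cong)
  also have "\<dots> = to_fract (R_num i) / d"
    by (simp add: R_num_def h.hom_sum sum_distrib_left divide_inverse mult.commute)
  finally show ?thesis using d by (simp add: d_def Fract_conv_to_fract)
qed

text \<open>Cramer's rule at a single point \<open>z\<close>, by multiplying with row
  \<open>k\<close> of the adjugate. It is stated without division, since the determinant may vanish
  at \<open>z\<close>.\<close>

lemma P_poly_solve:
  assumes k: "k < length ws"
    and x: "\<And>i. i < length ws \<Longrightarrow> (\<Sum>j<length ws. poly (P_entry a r m i j) z * x j) = g"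
  shows "poly (det P_poly) z * x k = g * poly (R_num k) z"
proof -
  let ?n = "length ws"
  let ?A = "adj_mat P_poly"
  note A = adj_mat[OF P_poly_carrier]
  have *: "(\<Sum>i<?n. poly (?A $$ (k, i)) z * poly (P_entry a r m i j) z) =
      (if j = k then poly (det P_poly) z else 0)" if j: "j < ?n" for j
  proof -
    have "(\<Sum>i<?n. ?A $$ (k, i) * P_entry a r m i j) = (?A * P_poly) $$ (k, j)"
      using A(1) j k by (auto simp: P_poly_def scalar_prod_def lessThan_atLeast0 intro!: sum.cong)
    also have "\<dots> = (if j = k then det P_poly else 0)"
      unfolding A(3) using j k by auto
    finally have "poly (\<Sum>i<?n. ?A $$ (k, i) * P_entry a r m i j) z =
        poly (if j = k then det P_poly else 0) z" by (rule arg_cong)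
    then show ?thesis by (simp add: poly_sum split: if_splits)
  qed
  have "g * poly (R_num k) z = (\<Sum>i<?n. poly (?A $$ (k, i)) z * (\<Sum>j<?n. poly (P_entry a r m i j) z * x j))"
    using x by (simp add: R_num_def poly_sum sum_distrib_left mult.commute)
  also have "\<dots> = (\<Sum>j<?n. (\<Sum>i<?n. poly (?A $$ (k, i)) z * poly (P_entry a r m i j) z) * x j)"
    unfolding sum_distrib_left sum_distrib_right mult.assoc by (rule sum.swap)
  also have "\<dots> = (\<Sum>j<?n. if j = k then poly (det P_poly) z * x k else 0)"
    by (intro sum.cong refl) (use * in auto)
  also have "\<dots> = poly (det P_poly) z * x k" using k by (simp add: sum.delta)
  finally show ?thesis by simp
qed

text \<open>To the right of \<open>t\<close> Cramer's rule identifies \<open>R_k\<close> with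
  \<open>gen_loss / (kappa k * gen)\<close> off the roots of the determinant, and
  \<open>gen_loss_bound\<close> keeps this bounded. So the rational function has a representation
  whose denominator is nonzero at \<open>t\<close>, even if \<open>det P_poly\<close> vanishes
  there.\<close>

lemma R_fun_regular:
  assumes t: "0 < t" and ev: "\<And>z. t < z \<Longrightarrow> summable_at z" and k: "k < length ws"
  obtains f g where "poly g t \<noteq> 0" "\<And>z. poly g z \<noteq> 0 \<Longrightarrow> R_fun a r m k z = poly f z / poly g z"
    "\<forall>\<^sub>F z in at_right t. R_fun a r m k z = gen_loss (ws ! k) z / (kappa k * gen z)"
proof -
  let ?d = "det P_poly"
  have right: "\<forall>\<^sub>F z in at_right t. t < z" by (simp add: eventually_at_right_less)
  have sol: "poly ?d z * (gen_loss (ws ! k) z / kappa k) = gen z * poly (R_num k) z" if "t < z" for z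
    by (rule P_poly_solve[OF k]) (rule P_solution[OF ev[OF that]])
  have ne: "ws ! k \<noteq> []" using k nonempty_words nth_mem by blast
  \<comment> \<open>The constant of \<open>gen_loss_bound\<close>, made independent of
    \<open>z\<close> by \<open>1 / z < 1 / t\<close>, over the modulus of
    \<open>kappa k\<close>.\<close>
  define B where "B = (1 / t + 1) / \<bar>kappa k\<bar>"
  have "\<forall>\<^sub>F z in at_right t. \<bar>poly (R_num k) z\<bar> \<le> B * \<bar>poly ?d z\<bar>"
    using right
  proof eventually_elim
    case (elim z)
    have g: "0 < gen z" by (rule gen_pos[OF ev[OF elim]])
    have "\<bar>poly (R_num k) z\<bar> * gen z = \<bar>poly ?d z * (gen_loss (ws ! k) z / kappa k)\<bar>"
      using g unfolding sol[OF elim] by (simp add: abs_mult)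
    also have "\<dots> = \<bar>poly ?d z\<bar> / \<bar>kappa k\<bar> * \<bar>gen_loss (ws ! k) z\<bar>" by (simp add: abs_mult)
    also have "\<dots> \<le> \<bar>poly ?d z\<bar> / \<bar>kappa k\<bar> * ((1 / z + 1) * gen z)"
      by (intro mult_left_mono gen_loss_bound ev elim ne) simp
    also have "\<dots> \<le> \<bar>poly ?d z\<bar> / \<bar>kappa k\<bar> * ((1 / t + 1) * gen z)"
      using elim t g by (intro mult_left_mono mult_right_mono add_right_mono divide_left_mono) auto
    also have "\<dots> = B * \<bar>poly ?d z\<bar> * gen z" by (simp add: B_def)
    finally show ?case using g by simp
  qed
  then obtain f g where fg: "Fraction_Field.Fract (R_num k) ?d = Fraction_Field.Fract f g" "poly g t \<noteq> 0"
    using Fract_removable[OF det_P_poly, of "R_num k" B t] by auto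
  have val: "R_fun a r m k z = poly f z / poly g z" if "poly g z \<noteq> 0" for z
    unfolding R_fun_def row_sum_inv_P[OF k] fg(1) using that by (rule ratfun_val_Fract)
  have "\<forall>\<^sub>F z in at_right t. poly ?d z \<noteq> 0"
    by (rule eventually_poly_nonzero[OF det_P_poly])
  with right have "\<forall>\<^sub>F z in at_right t. R_fun a r m k z = gen_loss (ws ! k) z / (kappa k * gen z)"
  proof eventually_elim
    case (elim z)
    have "R_fun a r m k z = poly (R_num k) z / poly ?d z"
      unfolding R_fun_def row_sum_inv_P[OF k] using elim(2) by (rule ratfun_val_Fract)
    also have "\<dots> = gen_loss (ws ! k) z / (kappa k * gen z)"
      using sol[OF elim(1)] elim(2) gen_pos[OF ev[OF elim(1)]] kappa_nonzero[of k]
      by (simp add: field_simps)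
    finally show ?case .
  qed
  with fg val show ?thesis using that by blast
qed

text \<open>Conjugating the transpose by \<open>D\<close> exchanges the factor
  \<open>kappa i\<close> for \<open>kappa j\<close> and leaves the diagonal term alone; exchanging
  the arguments of a correlation has the same effect as reversing both words.\<close>

lemma Q_mat_eq: "Q_mat a r m = P_mat (map rev a) (map rev r) m"
proof -
  let ?n = "length ws"
  define k where "k = (\<lambda>i. to_fract [:0, kappa i:] :: ratfun)"
  have k: "k i \<noteq> 0" for i using kappa_nonzero by (simp add: k_def)
  have D: "D_mat a r m = mat_diag ?n k"
    by (rule eq_matI) (auto simp: D_mat_def k_def kappa_def mat_diag_def)
  have inv: "inv_mat (D_mat a r m) = mat_diag ?n (\<lambda>i. inverse (k i))"
    unfolding D using k by (intro inv_mat_eq[of _ ?n]) (auto simp: mat_diag_diag)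
  interpret R: weighted_words "map rev a" "map rev r" m p by (rule reverse)
  have P: "P_mat a r m \<in> carrier_mat ?n ?n" by (simp add: P_mat_def)
  have rev_ws: "map rev r @ map rev a = map rev ws" by simp
  \<comment> \<open>The symmetry is visible for \<open>overlap\<close>; from there the polynomials
    are recovered by cancelling the factor \<open>z\<close>.\<close>
  have corr: "corr_poly (rev (ws ! j)) (rev (ws ! i)) = corr_poly (ws ! i) (ws ! j)"
    if "i < ?n" "j < ?n" for i j
  proof -
    have "z * poly (corr_poly (rev (ws ! j)) (rev (ws ! i))) z = z * poly (corr_poly (ws ! i) (ws ! j)) z" for z
      using R.overlap_words[of i j z] overlap_words[of j i z] that
      by (auto simp: overlap_rev simp flip: map_append)
    then have "poly ([:0, 1:] * corr_poly (rev (ws ! j)) (rev (ws ! i))) =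
        poly ([:0, 1:] * corr_poly (ws ! i) (ws ! j))" by (simp add: fun_eq_iff)
    then show ?thesis by (simp only: poly_eq_poly_eq_iff mult_left_cancel) simp
  qed
  have kap: "R.kappa = kappa" by (simp add: fun_eq_iff R.kappa_def kappa_def)
  show ?thesis
  proof (rule eq_matI)
    show "dim_row (Q_mat a r m) = dim_row (P_mat (map rev a) (map rev r) m)"
      "dim_col (Q_mat a r m) = dim_col (P_mat (map rev a) (map rev r) m)"
      unfolding Q_mat_def inv by (simp_all add: D P_mat_def mat_diag_def)
    fix i j assume "i < dim_row (P_mat (map rev a) (map rev r) m)"
      "j < dim_col (P_mat (map rev a) (map rev r) m)"
    then have ij: "i < ?n" "j < ?n" by (simp_all add: P_mat_def)
    have "Q_mat a r m $$ (i, j) = inverse (k i) * P_mat a r m $$ (j, i) * k j"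
    proof -
      have PT: "transpose_mat (P_mat a r m) \<in> carrier_mat ?n ?n" using P by simp
      let ?M = "mat ?n ?n (\<lambda>(i, j). inverse (k i) * transpose_mat (P_mat a r m) $$ (i, j))"
      have "Q_mat a r m = ?M * mat_diag ?n k"
        unfolding Q_mat_def inv mat_diag_mult_left[OF PT] unfolding D ..
      also have "\<dots> = mat ?n ?n (\<lambda>(i, j). ?M $$ (i, j) * k j)"
        by (rule mat_diag_mult_right) simp
      finally show ?thesis using ij P by simp
    qed
    also have "P_mat a r m $$ (j, i) = to_fract (P_entry a r m j i)"
      using ij by (simp add: P_mat_def)
    also have "inverse (k i) * to_fract (P_entry a r m j i) * k j =
        to_fract ([:0, kappa j:] * corr_poly (ws ! i) (ws ! j)
          - (if i = j \<and> i < length r then monom 1 p else 0))"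
    proof -
      have "P_entry a r m j i = [:0, kappa i:] * corr_poly (ws ! i) (ws ! j)
          - (if i = j \<and> i < length r then monom 1 p else 0)"
        using ij by (auto simp: P_entry_kappa)
      then have e1: "to_fract (P_entry a r m j i) = k i * to_fract (corr_poly (ws ! i) (ws ! j))
          - (if i = j \<and> i < length r then to_fract (monom 1 p) else 0)"
        unfolding k_def to_fract_mult[symmetric] by (simp del: mult_pCons_left)
      have e2: "to_fract ([:0, kappa j:] * corr_poly (ws ! i) (ws ! j)
          - (if i = j \<and> i < length r then monom 1 p else 0)) = k j * to_fract (corr_poly (ws ! i) (ws ! j))
          - (if i = j \<and> i < length r then to_fract (monom 1 p) else 0)"
        unfolding k_def to_fract_mult[symmetric] by (simp del: mult_pCons_left)
      show ?thesis unfolding e1 e2 using k[of i]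
        by (cases "i = j \<and> i < length r") (auto simp: field_simps)
    qed
    also have "\<dots> = to_fract (P_entry (map rev a) (map rev r) m i j)"
      using ij R.P_entry_kappa[of i j] corr[OF ij] by (simp add: kap flip: map_append)
    also have "\<dots> = P_mat (map rev a) (map rev r) m $$ (i, j)"
      using ij by (simp add: P_mat_def)
    finally show "Q_mat a r m $$ (i, j) = P_mat (map rev a) (map rev r) m $$ (i, j)" .
  qed
qed

lemma S_fun_eq: "S_fun a r m i = R_fun (map rev a) (map rev r) m i"
  by (simp add: S_fun_def R_fun_def Q_mat_eq)

end

section \<open>Allowed words and extendability\<close>

lemma avoids_sublist: "avoids a w \<Longrightarrow> sublist u w \<Longrightarrow> avoids a u"
  unfolding avoids_def by (meson sublist_order.order.trans)

text \<open>By compactness (Koenig's lemma) a word is allowed iff it has forbidden-word-free right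
  extensions of every length.\<close>

definition extendable :: "'a list list \<Rightarrow> 'a list \<Rightarrow> bool" where
  "extendable a w \<longleftrightarrow> (\<forall>n. \<exists>v. length v = n \<and> avoids a (w @ v))"

lemma extendable_avoids: "extendable a w \<Longrightarrow> avoids a w"
  unfolding extendable_def by (metis append_Nil2 length_0_conv)

lemma extendable_suffix:
  assumes "extendable a (u @ w)"
  shows "extendable a w"
  unfolding extendable_def
proof
  fix n
  obtain v where "length v = n" "avoids a ((u @ w) @ v)" using assms by (auto simp: extendable_def)
  then show "\<exists>v. length v = n \<and> avoids a (w @ v)"
    by (metis append.assoc avoids_sublist sublist_append_leftI)
qed

lemma extendable_prefix:
  assumes "extendable a (w @ u)"
  shows "extendable a w"
  unfolding extendable_def
proof
  fix n
  obtain v where v: "length v = n" "avoids a ((w @ u) @ v)" using assms by (auto simp: extendable_def)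
  have "prefix (w @ take n (u @ v)) ((w @ u) @ v)"
    by (simp add: take_is_prefix del: take_append)
  then have "avoids a (w @ take n (u @ v))"
    using v avoids_sublist prefix_imp_sublist by blast
  then show "\<exists>v. length v = n \<and> avoids a (w @ v)"
    using v by (intro exI[of _ "take n (u @ v)"]) auto
qed

text \<open>If each letter \<open>c\<close> failed at some length \<open>n c\<close>, a continuation
  of \<open>w\<close> by one letter more than the maximum of the finitely many \<open>n c\<close>
  would start with a letter that fails.\<close>

lemma extendable_snoc:
  fixes w :: "'a::finite list"
  assumes "extendable a w"
  shows "\<exists>c. extendable a (w @ [c])"
proof (rule ccontr)
  assume "\<not> ?thesis"
  then have "\<forall>c. \<exists>n. \<forall>v. length v = n \<longrightarrow> \<not> avoids a ((w @ [c]) @ v)"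
    by (auto simp: extendable_def)
  then obtain n where n: "\<And>c v. length v = n c \<Longrightarrow> \<not> avoids a ((w @ [c]) @ v)" by metis
  obtain v where v: "length v = Suc (Max (range n))" "avoids a (w @ v)"
    using assms unfolding extendable_def by blast
  then obtain c v' where cv: "v = c # v'" "length v' = Max (range n)" by (auto simp: length_Suc_conv)
  have "n c \<le> length v'" using cv by simp
  then have "length (take (n c) v') = n c" by simp
  moreover have "prefix ((w @ [c]) @ take (n c) v') (w @ v)"
    by (simp add: cv take_is_prefix)
  then have "avoids a ((w @ [c]) @ take (n c) v')"
    using v avoids_sublist prefix_imp_sublist by blast
  ultimately show False using n by blast
qed

lemma extendable_append:
  fixes w :: "'a::finite list"
  assumes "extendable a w"
  shows "\<exists>v. length v = n \<and> extendable a (w @ v)"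
proof (induction n)
  case 0
  show ?case using assms by (intro exI[of _ "[]"]) simp
next
  case (Suc n)
  then obtain v where "length v = n" "extendable a (w @ v)" by blast
  moreover from this obtain c where "extendable a ((w @ v) @ [c])" using extendable_snoc by blast
  ultimately show ?case by (intro exI[of _ "v @ [c]"]) simp
qed

lemma allowed_iff_extendable:
  fixes w :: "'a::finite list"
  shows "allowed (set a) w \<longleftrightarrow> extendable a w"
proof
  assume "allowed (set a) w"
  then obtain x k where x: "\<And>u. u \<in> set a \<Longrightarrow> \<not> subword_of_seq u x" and w: "map x [k..<k + length w] = w"
    by (auto simp: allowed_def shift_space_def subword_of_seq_def)
  have avoid: "avoids a (map x [i..<j])" for i j
    unfolding avoids_def
  proof (intro ballI notI)
    fix u assume u: "u \<in> set a" "sublist u (map x [i..<j])"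
    then obtain ps ss where e: "map x [i..<j] = ps @ u @ ss" by (auto simp: sublist_def)
    have len: "length ps + length u \<le> j - i" using arg_cong[OF e, of length] by simp
    have "map x [i + length ps..<i + length ps + length u] = u"
    proof (rule nth_equalityI)
      fix n assume n: "n < length (map x [i + length ps..<i + length ps + length u])"
      then have "u ! n = map x [i..<j] ! (length ps + n)" by (simp add: e nth_append)
      then show "map x [i + length ps..<i + length ps + length u] ! n = u ! n"
        using n len by (simp add: add.assoc)
    qed simp
    then show False using x[OF u(1)] unfolding subword_of_seq_def by blast
  qed
  show "extendable a w"
    unfolding extendable_def
  proof
    fix n
    let ?v = "map x [k + length w..<k + length w + n]"
    have "w @ ?v = map x [k..<k + length w + n]"
      using upt_add_eq_append[of k "k + length w" n] w by (metis map_append le_add1)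
    then show "\<exists>v. length v = n \<and> avoids a (w @ v)"
      using avoid[of k "k + length w + n"] by (intro exI[of _ ?v]) simp
  qed
next
  assume w: "extendable a w"
  \<comment> \<open>A chain of extendable words, each continuing the previous one by a letter;
    \<open>x\<close> below is its limit.\<close>
  define W where "W = rec_nat w (\<lambda>_ v. v @ [SOME c. extendable a (v @ [c])])"
  have W0: "W 0 = w" and WS: "W (Suc n) = W n @ [SOME c. extendable a (W n @ [c])]" for n
    by (simp_all add: W_def)
  have ext: "extendable a (W n)" for n
  proof (induction n)
    case (Suc n)
    then have "\<exists>c. extendable a (W n @ [c])" by (rule extendable_snoc)
    then show ?case unfolding WS by (rule someI_ex)
  qed (simp add: W0 w)
  have len: "length (W n) = length w + n" for n by (induction n) (simp_all add: W0 WS)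
  have step: "W (n + i) ! k = W n ! k" if "k < length w + n" for n i k
    using that len by (induction i) (simp_all add: WS nth_append)
  \<comment> \<open>\<open>W (Suc k)\<close> has more than \<open>k\<close> letters even if
    \<open>w\<close> is empty, and later words keep letter \<open>k\<close>.\<close>
  define x where "x = (\<lambda>k. W (Suc k) ! k)"
  have x: "W n ! k = x k" if "k < length w + n" for n k
    using step[of k n "Suc k"] step[of k "Suc k" n] that by (simp add: x_def add.commute)
  have mapx: "map x [0..<length w + n] = W n" for n
    by (rule nth_equalityI) (simp_all add: len x)
  have "x \<in> shift_space (set a)"
    unfolding shift_space_def subword_of_seq_def
  proof (intro CollectI ballI notI, elim exE)
    fix u k assume u: "u \<in> set a" and k: "map x [k..<k + length u] = u"
    have "u = map x (take (length u) (drop k [0..<length w + (k + length u)]))"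
      using k by (simp add: drop_upt take_upt)
    then have "u = take (length u) (drop k (W (k + length u)))"
      by (simp only: mapx[symmetric] take_map drop_map)
    then have "sublist u (W (k + length u))"
      by (metis sublist_take sublist_drop sublist_order.order.trans)
    then show False using extendable_avoids[OF ext] u by (auto simp: avoids_def)
  qed
  moreover have "subword_of_seq w x"
    unfolding subword_of_seq_def using mapx[of 0] W0 by (intro exI[of _ 0]) simp
  ultimately show "allowed (set a) w" unfolding allowed_def by blast
qed

lemma sum_words_append:
  fixes f :: "'a::finite list \<Rightarrow> real"
  shows "(\<Sum>w | length w = k + n. f w) = (\<Sum>u | length u = k. \<Sum>v | length v = n. f (u @ v))"
  unfolding sum.cartesian_product
  by (rule sum.reindex_bij_witness[of _ "\<lambda>(u, v). u @ v" "\<lambda>w. (take k w, drop k w)"]) auto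

section \<open>Allowed words as paths\<close>

context weighted_words
begin

text \<open>Positivity of the weight means avoidance, so this is the sign part of
  \<open>weight_glue\<close>.\<close>

lemma avoids_glue:
  assumes "length X = p - 1" "avoids a (u @ X)" "avoids a (X @ v)"
  shows "avoids a (u @ X @ v)"
  using weight_glue[OF assms(1), of u v] assms(2,3) by (metis mult_pos_pos weight_pos)

lemma extendable_glue:
  assumes "length X = p - 1" "avoids a (u @ X)" "extendable a (X @ v)"
  shows "extendable a (u @ X @ v)"
  unfolding extendable_def
proof
  fix n
  obtain s where "length s = n" "avoids a (X @ (v @ s))" using assms(3) by (auto simp: extendable_def)
  then show "\<exists>s. length s = n \<and> avoids a ((u @ X @ v) @ s)"
    using avoids_glue[OF assms(1,2), of "v @ s"] by auto
qed

text \<open>The weight restricted to allowed words, which are the ones that the adjacency matrix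
  sees.\<close>

definition ext_weight :: "'a list \<Rightarrow> real" where
  "ext_weight w = (if extendable a w then wt w else 0)"

lemma ext_weight_nonneg [simp]: "0 \<le> ext_weight w"
  by (simp add: ext_weight_def)

lemma ext_weight_glue:
  assumes "length X = p - 1"
  shows "ext_weight (u @ X @ v) = ext_weight (u @ X) * ext_weight (X @ v)"
proof (cases "avoids a (u @ X) \<and> extendable a (X @ v)")
  case True
  then have "extendable a (u @ X @ v)" using extendable_glue assms by blast
  moreover from this have "extendable a (u @ X)" using extendable_prefix[of a "u @ X" v] by simp
  ultimately show ?thesis using True weight_glue[OF assms, of u v] by (simp add: ext_weight_def)
next
  case False
  then have "\<not> extendable a (u @ X @ v)"
    using extendable_suffix[of a u "X @ v"] extendable_prefix[of a "u @ X" v] extendable_avoids[of a "u @ X"]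
    by auto
  moreover have "\<not> extendable a (u @ X) \<or> \<not> extendable a (X @ v)"
    using False extendable_avoids by blast
  ultimately show ?thesis by (auto simp: ext_weight_def)
qed

text \<open>For a vertex \<open>X\<close>, the row sum at \<open>X\<close> of the
  \<open>n\<close>-th power of the adjacency matrix: the number of paths with \<open>n\<close> edges
  that start there.\<close>

definition path_count :: "nat \<Rightarrow> 'a list \<Rightarrow> real" where
  "path_count n X = (\<Sum>v | length v = n. ext_weight (X @ v))"

lemma path_count_nonneg [simp]: "0 \<le> path_count n X"
  by (simp add: path_count_def sum_nonneg)

lemma path_count_0:
  assumes "X \<in> allowed_words (set a) (p - 1)"
  shows "path_count 0 X = 1"
proof -
  have X: "extendable a X" "length X < p"
    using assms two_le_p by (auto simp: allowed_words_def allowed_iff_extendable)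
  then have "wt X = 1" using weight_short extendable_avoids by auto
  then show ?thesis using X by (simp add: path_count_def ext_weight_def)
qed

lemma adj_eq:
  assumes "X \<in> allowed_words (set a) (p - 1)" "Y \<in> allowed_words (set a) (p - 1)"
  shows "real (adj a r m p X Y) = (if tl X = butlast Y then ext_weight (X @ [last Y]) else 0)"
  using assms two_le_p extendable_avoids[of a "X @ [last Y]"]
  by (auto simp: adj_def star_defined_def star_def allowed_words_def allowed_iff_extendable
      ext_weight_def weight_def)

text \<open>Gluing along the window \<open>tl X @ [c]\<close> splits off the first edge, which leads
  from \<open>X\<close> to that window; if the window is not allowed, no allowed word runs through
  it.\<close>

lemma path_count_Suc:
  assumes X: "X \<in> allowed_words (set a) (p - 1)"
  shows "path_count (Suc n) X =
    (\<Sum>Y\<in>allowed_words (set a) (p - 1). real (adj a r m p X Y) * path_count n Y)"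
proof -
  let ?L = "allowed_words (set a) (p - 1)"
  have lX: "length X = p - 1" using X by (simp add: allowed_words_def)
  then obtain x X' where xX: "X = x # X'" using two_le_p by (cases X) auto
  have finL: "finite ?L" by (rule finite_subset[OF _ finite_words[of "p - 1"]]) (auto simp: allowed_words_def)
  have glue: "ext_weight (X @ [c] @ v) = ext_weight (X @ [c]) * ext_weight ((X' @ [c]) @ v)" for c v
    using ext_weight_glue[of "X' @ [c]" "[x]" v] lX two_le_p by (simp add: xX)
  have "path_count (Suc n) X = (\<Sum>s | length s = 1 + n. ext_weight (X @ s))"
    by (simp add: path_count_def)
  also have "\<dots> = (\<Sum>s | length s = 1. \<Sum>v | length v = n. ext_weight (X @ s @ v))"
    by (rule sum_words_append)
  also have "\<dots> = (\<Sum>c\<in>UNIV. \<Sum>v | length v = n. ext_weight (X @ [c] @ v))"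
    by (rule sum.reindex_bij_witness[of _ "\<lambda>c. [c]" hd]) (auto simp: length_Suc_conv)
  also have "\<dots> = (\<Sum>c\<in>UNIV. ext_weight (X @ [c]) * path_count n (X' @ [c]))"
    unfolding glue path_count_def sum_distrib_left ..
  also have "\<dots> = (\<Sum>c | X' @ [c] \<in> ?L. ext_weight (X @ [c]) * path_count n (X' @ [c]))"
  proof (rule sum.mono_neutral_right)
    show "\<forall>c\<in>UNIV - {c. X' @ [c] \<in> ?L}. ext_weight (X @ [c]) * path_count n (X' @ [c]) = 0"
    proof
      fix c assume "c \<in> UNIV - {c. X' @ [c] \<in> ?L}"
      then have "\<not> extendable a (X' @ [c])"
        using lX two_le_p by (auto simp: allowed_words_def allowed_iff_extendable xX)
      then have "\<not> extendable a (X @ [c])"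
        using extendable_suffix[of a "[x]" "X' @ [c]"] by (auto simp: xX)
      then show "ext_weight (X @ [c]) * path_count n (X' @ [c]) = 0" by (simp add: ext_weight_def)
    qed
  qed auto
  also have "\<dots> = (\<Sum>Y\<in>{Y \<in> ?L. tl X = butlast Y}. ext_weight (X @ [last Y]) * path_count n Y)"
  proof (rule sum.reindex_bij_witness[of _ last "\<lambda>c. X' @ [c]"])
    fix Y assume Y: "Y \<in> {Y \<in> ?L. tl X = butlast Y}"
    then have "Y \<noteq> []" using two_le_p by (auto simp: allowed_words_def)
    with Y show "X' @ [last Y] = Y" "last Y \<in> {c. X' @ [c] \<in> ?L}"
      using append_butlast_last_id[of Y] by (auto simp: xX)
  qed (auto simp: xX)
  also have "\<dots> = (\<Sum>Y\<in>?L. if tl X = butlast Y then ext_weight (X @ [last Y]) * path_count n Y else 0)"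
    by (rule sum.inter_filter[OF finL])
  also have "\<dots> = (\<Sum>Y\<in>?L. real (adj a r m p X Y) * path_count n Y)"
    by (intro sum.cong refl) (simp add: adj_eq[OF X])
  finally show ?thesis .
qed

section \<open>Comparison of allowed words with all words avoiding the forbidden ones\<close>

lemma factor_le: "factor u \<le> (\<Prod>i<length r. real (m ! i))"
proof -
  have "1 \<le> real (m ! i)" if "i < length r" for i
    using that two_le_m[of "m ! i"] length_m by simp
  then have "(\<Prod>i<length r. if suffix (r ! i) u then real (m ! i) else 1) \<le> (\<Prod>i<length r. real (m ! i))"
    by (intro prod_mono) auto
  moreover have "0 \<le> (\<Prod>i<length r. real (m ! i))" by (intro prod_nonneg) simp
  ultimately show ?thesis by (simp add: factor_def)
qed

lemma weight_append_le: "wt (u @ v) \<le> wt u * (\<Prod>i<length r. real (m ! i)) ^ length v"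
proof (induction v rule: rev_induct)
  case (snoc c v)
  let ?M = "\<Prod>i<length r. real (m ! i)"
  have M: "0 \<le> ?M" by (intro prod_nonneg) simp
  have "wt (u @ v @ [c]) = wt (u @ v) * factor ((u @ v) @ [c])" using weight_snoc[of "u @ v" c] by simp
  also have "\<dots> \<le> (wt u * ?M ^ length v) * ?M"
    using snoc factor_le[of "(u @ v) @ [c]"] M factor_nonneg by (intro mult_mono) auto
  finally show ?case by (simp add: mult_ac)
qed simp

text \<open>There are finitely many windows, and each one that is not extendable stops at some
  finite length; \<open>K\<close> is the largest of these lengths.\<close>

lemma dead_end_bound:
  obtains K where "\<And>X v. length X = p - 1 \<Longrightarrow> length v = K \<Longrightarrow> avoids a (X @ v) \<Longrightarrow> extendable a X"
proof -
  have "\<forall>X. \<exists>n. extendable a X \<or> (\<forall>v. length v = n \<longrightarrow> \<not> avoids a (X @ v))"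
    by (auto simp: extendable_def)
  then obtain n where n: "\<And>X v. extendable a X \<or> (length v = n X \<longrightarrow> \<not> avoids a (X @ v))" by metis
  let ?N = "{X :: 'a list. length X = p - 1}"
  define K where "K = Max (insert 0 (n ` ?N))"
  have "extendable a X" if X: "length X = p - 1" "length v = K" "avoids a (X @ v)" for X v
  proof -
    have "n X \<le> K" using X(1) finite_words[of "p - 1"] by (auto simp: K_def)
    then have "length (take (n X) v) = n X" using X by simp
    moreover have "prefix (X @ take (n X) v) (X @ v)" by (simp add: take_is_prefix)
    then have "avoids a (X @ take (n X) v)" using X(3) avoids_sublist prefix_imp_sublist by blast
    ultimately show ?thesis using n by blast
  qed
  then show ?thesis using that by blast
qed

lemma weight_count_ge: 
  assumes "X \<in> allowed_words (set a) (p - 1)"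
  shows "path_count n X \<le> weight_count (p - 1 + n)"
proof -
  have "path_count n X \<le> (\<Sum>v | length v = n. wt (X @ v))"
    unfolding path_count_def by (intro sum_mono) (simp add: ext_weight_def)
  also have "\<dots> \<le> (\<Sum>X | length X = p - 1. \<Sum>v | length v = n. wt (X @ v))"
    using assms by (intro member_le_sum[of X]) (auto simp: allowed_words_def sum_nonneg finite_words)
  also have "\<dots> = weight_count (p - 1 + n)" unfolding weight_count_def by (rule sum_words_append[symmetric])
  finally show ?thesis .
qed

text \<open>Cutting off the last \<open>K\<close> letters leaves an extendable word, by
  \<open>dead_end_bound\<close> and gluing, and \<open>K\<close> letters change the weight by a
  bounded factor. So all words together grow no faster than the paths.\<close>

lemma weight_count_le:
  obtains K C where "0 \<le> C"
    "\<And>n. weight_count (p - 1 + n + K) \<le> C * (\<Sum>X\<in>allowed_words (set a) (p - 1). path_count n X)"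
proof -
  obtain K where K: "\<And>X v. length X = p - 1 \<Longrightarrow> length v = K \<Longrightarrow> avoids a (X @ v) \<Longrightarrow> extendable a X"
    by (rule dead_end_bound) blast
  let ?M = "\<Prod>i<length r. real (m ! i)"
  let ?L = "allowed_words (set a) (p - 1)"
  define C where "C = real (card {v :: 'a list. length v = K}) * ?M ^ K"
  have M: "0 \<le> ?M" by (intro prod_nonneg) simp
  have le: "wt (u @ v) \<le> ext_weight u * ?M ^ K" if "p - 1 \<le> length u" "length v = K" for u v
  proof (cases "avoids a (u @ v)")
    case True
    define X where "X = drop (length u - (p - 1)) u"
    define u' where "u' = take (length u - (p - 1)) u"
    have u: "u = u' @ X" by (simp add: u'_def X_def)
    have lX: "length X = p - 1" using that by (simp add: X_def)
    have "avoids a (X @ v)" using True avoids_sublist[of a "u @ v" "X @ v"] by (simp add: u)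
    then have "extendable a X" using K lX that by blast
    moreover have "avoids a (u' @ X)" using True avoids_sublist[of a "u @ v" u] by (simp add: u)
    ultimately have "extendable a u" using extendable_glue[OF lX, of u' "[]"] by (simp add: u)
    then show ?thesis using weight_append_le[of u v] that by (simp add: ext_weight_def)
  next
    case False
    then have "wt (u @ v) = 0" by (simp add: weight_def)
    then show ?thesis using M by simp
  qed
  have "weight_count (p - 1 + n + K) \<le> C * (\<Sum>X\<in>?L. path_count n X)" for n
  proof -
    have "weight_count (p - 1 + n + K) = (\<Sum>u | length u = p - 1 + n. \<Sum>v | length v = K. wt (u @ v))"
      unfolding weight_count_def by (rule sum_words_append)
    also have "\<dots> \<le> (\<Sum>u | length u = p - 1 + n. \<Sum>v :: 'a list | length v = K. ext_weight u * ?M ^ K)"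
    proof (rule sum_mono)
      fix u :: "'a list" assume "u \<in> {u. length u = p - 1 + n}"
      then have "wt (u @ v) \<le> ext_weight u * ?M ^ K" if "length v = K" for v
        using le[OF _ that, of u] by simp
      then show "(\<Sum>v | length v = K. wt (u @ v)) \<le> (\<Sum>v :: 'a list | length v = K. ext_weight u * ?M ^ K)"
        by (intro sum_mono) auto
    qed
    also have "\<dots> = C * (\<Sum>u | length u = p - 1 + n. ext_weight u)"
      by (simp add: C_def sum_distrib_left mult_ac)
    also have "(\<Sum>u | length u = p - 1 + n. ext_weight u) = (\<Sum>X | length X = p - 1. path_count n X)"
      unfolding path_count_def by (rule sum_words_append)
    also have "\<dots> = (\<Sum>X\<in>?L. path_count n X)"
    proof (rule sum.mono_neutral_right[OF finite_words])
      show "\<forall>X\<in>{X. length X = p - 1} - ?L. path_count n X = 0"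
      proof
        fix X assume "X \<in> {X. length X = p - 1} - ?L"
        then have "\<not> extendable a X" by (auto simp: allowed_words_def allowed_iff_extendable)
        then have "\<not> extendable a (X @ v)" for v using extendable_prefix by blast
        then show "path_count n X = 0" by (simp add: path_count_def ext_weight_def)
      qed
    qed (auto simp: allowed_words_def)
    finally show ?thesis .
  qed
  moreover have "0 \<le> C" using M by (simp add: C_def)
  ultimately show ?thesis using that by blast
qed

text \<open>Only finitely many continuations of \<open>X\<close> avoid the forbidden words, and for
  \<open>z \<ge> 1\<close> each term is at most its weight. The bound is uniform in
  \<open>z\<close>, which makes dead ends negligible against the diverging
  \<open>gen z\<close>.\<close>

lemma gen_start_dead_end:
  assumes X: "length X = p - 1" "\<not> extendable a X"
  obtains C where "\<And>z. 1 \<le> z \<Longrightarrow> gen_start X z \<le> C"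
proof -
  obtain K where K: "\<And>X v. length X = p - 1 \<Longrightarrow> length v = K \<Longrightarrow> avoids a (X @ v) \<Longrightarrow> extendable a X"
    by (rule dead_end_bound) blast
  have fin: "finite {v :: 'a list. length v < K}"
    by (rule finite_subset[OF _ finite_lists_length_le[of UNIV K]]) auto
  have zero: "wt (X @ v) = 0" if "K \<le> length v" for v
  proof -
    have "prefix (X @ take K v) (X @ v)" by (simp add: take_is_prefix)
    then have "\<not> avoids a (X @ v)"
      using K[OF X(1), of "take K v"] X(2) that avoids_sublist prefix_imp_sublist by fastforce
    then show ?thesis by (simp add: weight_def)
  qed
  have "gen_start X z \<le> (\<Sum>v | length v < K. wt (X @ v))" if "1 \<le> z" for z
  proof -
    have "gen_start X z = (\<Sum>\<^sub>\<infinity>v\<in>{v. length v < K}. wt (X @ v) / z ^ length (X @ v))"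
      unfolding gen_start_def by (rule infsum_cong_neutral) (use zero in \<open>auto simp: not_less\<close>)
    also have "\<dots> = (\<Sum>v | length v < K. wt (X @ v) / z ^ length (X @ v))" using fin by simp
    also have "\<dots> \<le> (\<Sum>v | length v < K. wt (X @ v))"
    proof (rule sum_mono)
      fix v
      have "1 \<le> z ^ length (X @ v)" using that by (rule one_le_power)
      then have "wt (X @ v) / z ^ length (X @ v) \<le> wt (X @ v) / 1"
        by (intro divide_left_mono) auto
      then show "wt (X @ v) / z ^ length (X @ v) \<le> wt (X @ v)" by simp
    qed
    finally show ?thesis .
  qed
  then show ?thesis using that by blast
qed

end

section \<open>Spectral radius and growth\<close>

context weighted_words
begin

context
  fixes vs :: "'a list list" and \<theta> :: real
  assumes vs: "distinct vs" "set vs = allowed_words (set a) (p - 1)"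
    and letter: "\<exists>c. allowed (set a) [c]"
    and theta: "\<theta> = spectral_radius (adjacency_mat a r m p vs)" "1 < \<theta>"
begin

lemma adjacency_carrier: "adjacency_mat a r m p vs \<in> carrier_mat (length vs) (length vs)"
  by (simp add: adjacency_mat_def)

text \<open>A matrix of size 0 has no eigenvalue; positive size ensures that the spectral radius is
  attained.\<close>

lemma vs_nonempty: "0 < length vs"
proof -
  obtain c where "extendable a [c]" using letter by (auto simp: allowed_iff_extendable)
  then obtain v where "length v = p - 2" "extendable a ([c] @ v)"
    using extendable_append by blast
  then have "[c] @ v \<in> set vs"
    using two_le_p by (simp add: vs allowed_words_def allowed_iff_extendable)
  then show ?thesis by auto
qed

lemma sum_allowed: "(\<Sum>X\<in>allowed_words (set a) (p - 1). f X) = (\<Sum>j<length vs. f (vs ! j))"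
  using sum.reindex_bij_betw[OF bij_betw_nth[OF vs(1) refl refl], of f] by (simp add: vs)

lemma nth_vs: "i < length vs \<Longrightarrow> vs ! i \<in> allowed_words (set a) (p - 1)"
  using vs(2) nth_mem by blast

lemma path_count_step: "i < length vs \<Longrightarrow>
  path_count (Suc n) (vs ! i) = (\<Sum>j<length vs. real (adj a r m p (vs ! i) (vs ! j)) * path_count n (vs ! j))"
  unfolding path_count_Suc[OF nth_vs] sum_allowed ..

text \<open>The matrix \<open>A / s\<close> has spectral radius below 1, so by the Jordan normal
  form its powers stay bounded entrywise; the vector of path counts is the \<open>n\<close>-th power
  of \<open>A\<close> applied to the all-one vector.\<close>

lemma path_count_upper:
  assumes s: "\<theta> < s"
  obtains c where "\<And>n i. i < length vs \<Longrightarrow> path_count n (vs ! i) \<le> c * s ^ n"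
proof -
  let ?N = "length vs"
  let ?A = "adjacency_mat a r m p vs"
  note A = adjacency_carrier
  have s0: "0 < s" using s theta by simp
  define B where "B = complex_of_real (1 / s) \<cdot>\<^sub>m ?A"
  have B: "B \<in> carrier_mat ?N ?N" using A by (simp add: B_def)
  have "spectral_radius B < 1"
  proof -
    obtain ev where ev: "ev \<in> spectrum B" "spectral_radius B = norm ev"
      using spectral_radius_mem_max(1)[OF B vs_nonempty] by auto
    then obtain v where "eigenvector B v ev" by (auto simp: spectrum_def eigenvalue_def)
    then have v: "v \<in> carrier_vec ?N" "v \<noteq> 0\<^sub>v ?N" "B *\<^sub>v v = ev \<cdot>\<^sub>v v"
      using B by (auto simp: eigenvector_def)
    have "?A *\<^sub>v v = complex_of_real s \<cdot>\<^sub>v (B *\<^sub>v v)"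
      unfolding B_def using A v s0
      by (intro eq_vecI) (auto simp: scalar_prod_def sum_distrib_left)
    also have "\<dots> = (complex_of_real s * ev) \<cdot>\<^sub>v v" using v by (simp add: smult_smult_assoc)
    finally have "complex_of_real s * ev \<in> spectrum ?A"
      using v A unfolding spectrum_def eigenvalue_def eigenvector_def by auto
    then have "norm (complex_of_real s * ev) \<le> \<theta>"
      unfolding theta(1) by (intro spectral_radius_mem_max(2)[OF A vs_nonempty] imageI)
    then have "s * norm ev \<le> \<theta>" using s0 by (simp add: norm_mult)
    then have "s * norm ev < s * 1" using s by simp
    then show ?thesis using s0 ev(2) by simp
  qed
  then obtain c where c: "\<And>k. norm_bound (B ^\<^sub>m k) c"
    using spectral_radius_jnf_norm_bound_less_1_upper_triangular[OF B] by blast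
  define C where "C = (\<lambda>n. vec ?N (\<lambda>i. complex_of_real (path_count n (vs ! i) / s ^ n)))"
  have C: "C n \<in> carrier_vec ?N" for n by (simp add: C_def)
  have step: "B *\<^sub>v C n = C (Suc n)" for n
  proof (rule eq_vecI)
    fix i assume "i < dim_vec (C (Suc n))"
    then have i: "i < ?N" by (simp add: C_def)
    have "(B *\<^sub>v C n) $ i = (\<Sum>j<?N. complex_of_real (1 / s) *
        of_nat (adj a r m p (vs ! i) (vs ! j)) * complex_of_real (path_count n (vs ! j) / s ^ n))"
      using i by (simp add: B_def C_def adjacency_mat_def scalar_prod_def lessThan_atLeast0)
    also have "\<dots> = complex_of_real (\<Sum>j<?N. 1 / s * real (adj a r m p (vs ! i) (vs ! j)) *
        (path_count n (vs ! j) / s ^ n))" by simp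
    also have "(\<Sum>j<?N. 1 / s * real (adj a r m p (vs ! i) (vs ! j)) * (path_count n (vs ! j) / s ^ n))
        = path_count (Suc n) (vs ! i) / s ^ Suc n"
      unfolding path_count_step[OF i] sum_divide_distrib by (intro sum.cong) auto
    finally show "(B *\<^sub>v C n) $ i = C (Suc n) $ i" using i by (simp add: C_def)
  qed (use B in \<open>simp add: C_def\<close>)
  have pow: "B ^\<^sub>m n *\<^sub>v C k = C (n + k)" for n k
  proof (induction n arbitrary: k)
    case 0
    show ?case using B C by simp
  next
    case (Suc n)
    have "B ^\<^sub>m Suc n *\<^sub>v C k = B ^\<^sub>m n *\<^sub>v (B *\<^sub>v C k)"
      using B C by (simp add: assoc_mult_mat_vec[of _ ?N ?N _ ?N])
    then show ?case using Suc step by simp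
  qed
  have "path_count n (vs ! i) \<le> (real ?N * c) * s ^ n" if i: "i < ?N" for n i
  proof -
    have Bn: "B ^\<^sub>m n \<in> carrier_mat ?N ?N" using B by simp
    have "C n $ i = (B ^\<^sub>m n *\<^sub>v C 0) $ i" using pow[of n 0] by simp
    also have "\<dots> = (\<Sum>j<?N. (B ^\<^sub>m n) $$ (i, j) * C 0 $ j)"
    proof -
      have "(M *\<^sub>v x) $ i = (\<Sum>j<?N. M $$ (i, j) * x $ j)"
        if "M \<in> carrier_mat ?N ?N" "x \<in> carrier_vec ?N" for M :: "complex mat" and x
        using that i by (auto simp: scalar_prod_def lessThan_atLeast0)
      from this[OF Bn C] show ?thesis .
    qed
    finally have Cn: "C n $ i = (\<Sum>j<?N. (B ^\<^sub>m n) $$ (i, j) * C 0 $ j)" .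
    have "path_count n (vs ! i) / s ^ n = norm (\<Sum>j<?N. (B ^\<^sub>m n) $$ (i, j) * C 0 $ j)"
      unfolding Cn[symmetric] using i s0 by (simp add: C_def norm_divide norm_power)
    also have "\<dots> \<le> (\<Sum>j<?N. c)"
    proof (rule sum_norm_le)
      fix j assume j: "j \<in> {..<?N}"
      then have "C 0 $ j = 1" using path_count_0[OF nth_vs, of j] by (simp add: C_def)
      then show "norm ((B ^\<^sub>m n) $$ (i, j) * C 0 $ j) \<le> c"
        using c[of n] i j Bn B by (auto simp: norm_bound_def split: if_splits)
    qed
    finally show ?thesis using s0 by (simp add: field_simps)
  qed
  then show ?thesis using that by blast
qed

text \<open>Take an eigenvalue of modulus \<theta>, real or not, with eigenvector \<open>v\<close>.
  The triangle inequality in \<open>A v = ev v\<close> gives \<open>\<theta> |v| \<le> A |v|\<close>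
  entrywise, and iteration compares \<open>\<theta> ^ n |v|\<close> with the path counts.\<close>

lemma path_count_lower:
  obtains X c where "X \<in> allowed_words (set a) (p - 1)" "0 < c" "\<And>n. c * \<theta> ^ n \<le> path_count n X"
proof -
  let ?N = "length vs"
  let ?A = "adjacency_mat a r m p vs"
  note A = adjacency_carrier
  obtain ev where ev: "ev \<in> spectrum ?A" "\<theta> = norm ev"
    using spectral_radius_mem_max(1)[OF A vs_nonempty] unfolding theta(1) by auto
  then obtain v where "eigenvector ?A v ev" by (auto simp: spectrum_def eigenvalue_def)
  then have v: "v \<in> carrier_vec ?N" "v \<noteq> 0\<^sub>v ?N" and Av: "?A *\<^sub>v v = ev \<cdot>\<^sub>v v"
    using A by (auto simp: eigenvector_def)
  have Avi: "ev * v $ i = (\<Sum>j<?N. of_nat (adj a r m p (vs ! i) (vs ! j)) * v $ j)" if i: "i < ?N" for i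
    using arg_cong[OF Av, of "\<lambda>v. v $ i"] i v
    by (simp add: adjacency_mat_def scalar_prod_def lessThan_atLeast0)
  define M where "M = (\<Sum>j<?N. norm (v $ j))"
  have le: "\<theta> ^ n * norm (v $ i) \<le> M * path_count n (vs ! i)" if "i < ?N" for n i
    using that
  proof (induction n arbitrary: i)
    case 0
    then have "norm (v $ i) \<le> M" unfolding M_def by (intro member_le_sum) auto
    with 0 show ?case by (simp only: path_count_0[OF nth_vs]) simp
  next
    case (Suc n)
    have "\<theta> ^ Suc n * norm (v $ i) = \<theta> ^ n * norm (ev * v $ i)" by (simp add: ev norm_mult)
    also have "\<dots> \<le> \<theta> ^ n * (\<Sum>j<?N. real (adj a r m p (vs ! i) (vs ! j)) * norm (v $ j))"
      unfolding Avi[OF Suc.prems] using theta(2)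
      by (intro mult_left_mono sum_norm_le) (auto simp: norm_mult)
    also have "\<dots> = (\<Sum>j<?N. real (adj a r m p (vs ! i) (vs ! j)) * (\<theta> ^ n * norm (v $ j)))"
      by (simp add: sum_distrib_left mult.left_commute)
    also have "\<dots> \<le> (\<Sum>j<?N. real (adj a r m p (vs ! i) (vs ! j)) * (M * path_count n (vs ! j)))"
      by (intro sum_mono mult_left_mono Suc.IH) auto
    also have "\<dots> = M * path_count (Suc n) (vs ! i)"
      unfolding path_count_step[OF Suc.prems] by (simp add: sum_distrib_left mult.left_commute)
    finally show ?case .
  qed
  obtain i where i: "i < ?N" "v $ i \<noteq> 0" using v by (auto simp: vec_eq_iff)
  then have "norm (v $ i) \<le> M" unfolding M_def by (intro member_le_sum) auto
  then have M: "0 < M" using i by (meson less_le_trans zero_less_norm_iff)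
  have "(norm (v $ i) / M) * \<theta> ^ n \<le> path_count n (vs ! i)" for n
    using le[OF i(1), of n] M by (simp add: field_simps)
  then show ?thesis using that[of "vs ! i" "norm (v $ i) / M"] i M nth_vs by simp
qed

lemma summable_above:
  assumes z: "\<theta> < z"
  shows "summable_at z"
proof (rule summable_atI)
  show "0 < z" using z theta by simp
  \<comment> \<open>Path counts are bounded by multiples of \<open>s ^ n\<close> only for
    \<open>s > \<theta>\<close>, so \<open>s\<close> is placed strictly between to keep
    \<open>s / z\<close> below 1.\<close>
  obtain s where s: "\<theta> < s" "s < z" using z dense by blast
  have s0: "0 < s" using s theta by simp
  obtain c where c: "\<And>n i. i < length vs \<Longrightarrow> path_count n (vs ! i) \<le> c * s ^ n"
    using path_count_upper[OF s(1)] by blast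
  obtain K C where C: "0 \<le> C"
    "\<And>n. weight_count (p - 1 + n + K) \<le> C * (\<Sum>X\<in>allowed_words (set a) (p - 1). path_count n X)"
    by (rule weight_count_le) blast
  define C' where "C' = C * (real (length vs) * c) * (1 / z) ^ (p - 1 + K)"
  have le: "weight_count (n + (p - 1 + K)) * (1 / z) ^ (n + (p - 1 + K)) \<le> C' * (s / z) ^ n" for n
  proof -
    have "weight_count (n + (p - 1 + K)) \<le> C * (\<Sum>i<length vs. path_count n (vs ! i))"
      using C(2)[of n] unfolding sum_allowed by (simp add: ac_simps)
    also have "\<dots> \<le> C * (\<Sum>i<length vs. c * s ^ n)"
      using C(1) c by (intro mult_left_mono sum_mono) auto
    finally have "weight_count (n + (p - 1 + K)) \<le> C * (real (length vs) * c) * s ^ n" by simp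
    then have "weight_count (n + (p - 1 + K)) * (1 / z) ^ (n + (p - 1 + K)) \<le>
        C * (real (length vs) * c) * s ^ n * (1 / z) ^ (n + (p - 1 + K))"
      using z theta by (intro mult_right_mono) auto
    also have "\<dots> = C' * (s / z) ^ n" by (simp add: C'_def power_add power_divide)
    finally show ?thesis .
  qed
  have "summable (\<lambda>n. weight_count (n + (p - 1 + K)) * (1 / z) ^ (n + (p - 1 + K)))"
  proof (rule summable_comparison_test')
    show "summable (\<lambda>n. C' * (s / z) ^ n)"
      using s s0 by (intro summable_mult summable_geometric) auto
    fix n
    have "0 \<le> weight_count (n + (p - 1 + K)) * (1 / z) ^ (n + (p - 1 + K))"
      using z theta by (intro mult_nonneg_nonneg zero_le_power) auto
    then show "norm (weight_count (n + (p - 1 + K)) * (1 / z) ^ (n + (p - 1 + K))) \<le> C' * (s / z) ^ n"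
      using le[of n] by (simp only: real_norm_def abs_of_nonneg)
  qed
  then show "summable (\<lambda>n. weight_count n * (1 / z) ^ n)"
    by (rule summable_iff_shift[of "\<lambda>n. weight_count n * (1 / z) ^ n" "p - 1 + K", THEN iffD1])
qed

text \<open>The lower bound \<open>c * \<theta> ^ n\<close> on one path count sums to a geometric
  series, which blows up like \<open>1 / (z - \<theta>)\<close>.\<close>

lemma gen_at_top: "filterlim gen at_top (at_right \<theta>)"
proof -
  obtain X c where X: "X \<in> allowed_words (set a) (p - 1)" and c: "0 < c" "\<And>n. c * \<theta> ^ n \<le> path_count n X"
    by (rule path_count_lower) blast
  \<comment> \<open>For \<open>\<theta> < z < 2 * \<theta>\<close> the factor
    \<open>z / z ^ (p - 1)\<close> left over from the geometric series is at least
    \<open>\<theta> / (2 * \<theta>) ^ (p - 1)\<close>.\<close>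
  define c' where "c' = c * (\<theta> / (2 * \<theta>) ^ (p - 1))"
  have c': "0 < c'" using c theta by (simp add: c'_def)
  have bound: "c' * inverse (z - \<theta>) \<le> gen z" if z: "\<theta> < z" "z < 2 * \<theta>" for z
  proof -
    have zpos: "0 < z" using z theta by simp
    let ?f = "\<lambda>n. weight_count n * (1 / z) ^ n"
    have sm: "?f sums gen z" by (rule gen_sums[OF summable_above[OF z(1)]])
    have "(\<lambda>n. c * (1 / z) ^ (p - 1) * (\<theta> / z) ^ n) sums (c * (1 / z) ^ (p - 1) * (1 / (1 - \<theta> / z)))"
      using z theta by (intro sums_mult geometric_sums) auto
    moreover have "(\<lambda>n. ?f (n + (p - 1))) sums (gen z - (\<Sum>i<p - 1. ?f i))"
      by (rule sums_split_initial_segment[OF sm])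
    moreover have "c * (1 / z) ^ (p - 1) * (\<theta> / z) ^ n \<le> ?f (n + (p - 1))" for n
    proof -
      have "c * \<theta> ^ n * (1 / z) ^ (n + (p - 1)) \<le> ?f (n + (p - 1))"
        using c(2)[of n] weight_count_ge[OF X, of n] zpos
        by (intro mult_right_mono) (auto simp: add.commute)
      then show ?thesis by (simp add: power_add power_divide mult.commute)
    qed
    ultimately have "c * (1 / z) ^ (p - 1) * (1 / (1 - \<theta> / z)) \<le> gen z - (\<Sum>i<p - 1. ?f i)"
      by (rule sums_le[rotated 1, OF _ _]) 
    also have "\<dots> \<le> gen z" using zpos by (simp add: sum_nonneg)
    also have "c * (1 / z) ^ (p - 1) * (1 / (1 - \<theta> / z)) = c * (z / z ^ (p - 1)) * inverse (z - \<theta>)"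
      using zpos z by (simp add: field_simps)
    finally have le: "c * (z / z ^ (p - 1)) * inverse (z - \<theta>) \<le> gen z" .
    have "\<theta> / (2 * \<theta>) ^ (p - 1) \<le> z / z ^ (p - 1)"
      using z theta by (intro frac_le power_mono) auto
    then have "c' * inverse (z - \<theta>) \<le> c * (z / z ^ (p - 1)) * inverse (z - \<theta>)"
      unfolding c'_def using c z by (intro mult_right_mono mult_left_mono) auto
    with le show ?thesis by simp
  qed
  have "filterlim (\<lambda>z. inverse (z - \<theta>)) at_top (at_right \<theta>)"
    by (subst filterlim_at_right_to_0) (simp add: filterlim_inverse_at_top_right)
  then have "filterlim (\<lambda>z. c' * inverse (z - \<theta>)) at_top (at_right \<theta>)"
    using c' by (intro filterlim_tendsto_pos_mult_at_top[OF tendsto_const])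
  moreover have "\<forall>\<^sub>F z in at_right \<theta>. c' * inverse (z - \<theta>) \<le> gen z"
    unfolding eventually_at_right_field
    using bound theta by (intro exI[of _ "2 * \<theta>"]) auto
  ultimately show ?thesis by (rule filterlim_at_top_mono)
qed

end

end

section \<open>Regularity and limits at the Perron root\<close>

text \<open>A rational function without a pole at \<open>t\<close>. The equation is asked only off
  the zeros of \<open>g\<close>, because \<open>ratfun_val\<close> is unspecified at poles.\<close>

definition regular_at :: "real \<Rightarrow> (real \<Rightarrow> real) \<Rightarrow> bool" where
  "regular_at t h \<longleftrightarrow> (\<exists>f g. poly g t \<noteq> 0 \<and> (\<forall>z. poly g z \<noteq> 0 \<longrightarrow> h z = poly f z / poly g z))"

lemma regular_at_poly: "regular_at t (poly f)"
  unfolding regular_at_def by (intro exI[of _ f] exI[of _ 1]) simp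

lemma regular_at_add:
  assumes "regular_at t h1" "regular_at t h2"
  shows "regular_at t (\<lambda>z. h1 z + h2 z)"
proof -
  obtain f1 g1 f2 g2 where "poly g1 t \<noteq> 0" "\<And>z. poly g1 z \<noteq> 0 \<Longrightarrow> h1 z = poly f1 z / poly g1 z"
    "poly g2 t \<noteq> 0" "\<And>z. poly g2 z \<noteq> 0 \<Longrightarrow> h2 z = poly f2 z / poly g2 z"
    using assms unfolding regular_at_def by metis
  then show ?thesis unfolding regular_at_def
    by (intro exI[of _ "f1 * g2 + f2 * g1"] exI[of _ "g1 * g2"]) (simp add: add_frac_eq)
qed

lemma regular_at_mult:
  assumes "regular_at t h1" "regular_at t h2"
  shows "regular_at t (\<lambda>z. h1 z * h2 z)"
proof -
  obtain f1 g1 f2 g2 where "poly g1 t \<noteq> 0" "\<And>z. poly g1 z \<noteq> 0 \<Longrightarrow> h1 z = poly f1 z / poly g1 z"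
    "poly g2 t \<noteq> 0" "\<And>z. poly g2 z \<noteq> 0 \<Longrightarrow> h2 z = poly f2 z / poly g2 z"
    using assms unfolding regular_at_def by metis
  then show ?thesis unfolding regular_at_def
    by (intro exI[of _ "f1 * f2"] exI[of _ "g1 * g2"]) simp
qed

lemma regular_at_sum:
  assumes "\<And>k. k \<in> K \<Longrightarrow> regular_at t (h k)"
  shows "regular_at t (\<lambda>z. \<Sum>k\<in>K. h k z)"
  using assms regular_at_poly[of t 0]
  by (induction K rule: infinite_finite_induct) (auto simp: poly_0[abs_def] intro: regular_at_add)

text \<open>The derivative is needed near \<open>t\<close> and with continuity at \<open>t\<close>:
  the identity for \<open>gen\<close> is differentiated to the right of the Perron root, and the
  result is passed to the limit.\<close>

lemma regular_at_derivative:
  assumes "regular_at t h"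
  obtains h' where "\<forall>\<^sub>F z in nhds t. (h has_real_derivative h' z) (at z)" "isCont h' t"
proof -
  obtain f g where g: "poly g t \<noteq> 0" and h: "\<And>z. poly g z \<noteq> 0 \<Longrightarrow> h z = poly f z / poly g z"
    using assms unfolding regular_at_def by metis
  define h' where "h' = (\<lambda>z. (poly (pderiv f) z * poly g z - poly f z * poly (pderiv g) z) / (poly g z * poly g z))"
  have op: "open {z. poly g z \<noteq> 0}"
    by (intro open_Collect_neq continuous_intros)
  have "(h has_real_derivative h' z) (at z)" if "poly g z \<noteq> 0" for z
  proof (rule has_field_derivative_transform_within_open[OF _ op])
    show "((\<lambda>z. poly f z / poly g z) has_real_derivative h' z) (at z)"
      unfolding h'_def using that by (intro DERIV_divide poly_DERIV) auto
  qed (use that h in auto)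
  moreover have "\<forall>\<^sub>F z in nhds t. z \<in> {z. poly g z \<noteq> 0}"
    using op g by (intro eventually_nhds_in_open) auto
  ultimately have "\<forall>\<^sub>F z in nhds t. (h has_real_derivative h' z) (at z)"
    by (auto elim: eventually_mono)
  moreover have "isCont h' t" unfolding h'_def using g by (intro continuous_intros) auto
  ultimately show ?thesis using that by blast
qed

lemma regular_at_isCont: "regular_at t h \<Longrightarrow> isCont h t"
  by (metis regular_at_derivative DERIV_isCont eventually_nhds_x_imp_x)

section \<open>Limits for words ending or starting with a window\<close>

context weighted_words
begin

lemma sum_words:
  fixes f :: "nat \<Rightarrow> real"
  shows "(\<Sum>k<length ws. f k) = (\<Sum>i<length r. f i) + (\<Sum>j<length a. f (length r + j))"
proof -
  have "(\<Sum>k<n + s. f k) = (\<Sum>i<n. f i) + (\<Sum>j<s. f (n + j))" for n s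
    by (induction s) (simp_all add: add.assoc)
  then show ?thesis by simp
qed

lemma R_total_eq: "R_total a r m z = z * (\<Sum>k<length ws. kappa k * R_fun a r m k z)"
  unfolding sum_words R_total_def by (simp add: kappa_def algebra_simps sum_negf)

lemma R_fun_regular_at:
  assumes "0 < t" "\<And>z. t < z \<Longrightarrow> summable_at z" "k < length ws"
  shows "regular_at t (R_fun a r m k)"
  using R_fun_regular[OF assms] unfolding regular_at_def by metis

lemma R_fun_eventually:
  assumes "0 < t" "\<And>z. t < z \<Longrightarrow> summable_at z"
  shows "\<forall>\<^sub>F z in at_right t. \<forall>k<length ws. kappa k * R_fun a r m k z = gen_loss (ws ! k) z / gen z"
proof -
  have "\<forall>\<^sub>F z in at_right t. kappa k * R_fun a r m k z = gen_loss (ws ! k) z / gen z"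
    if k: "k < length ws" for k
  proof -
    have "\<forall>\<^sub>F z in at_right t. R_fun a r m k z = gen_loss (ws ! k) z / (kappa k * gen z)"
      using R_fun_regular[OF assms k] by metis
    then show ?thesis by eventually_elim (simp add: kappa_nonzero)
  qed
  then have "\<forall>\<^sub>F z in at_right t. \<forall>k\<in>{..<length ws}. kappa k * R_fun a r m k z = gen_loss (ws ! k) z / gen z"
    by (intro eventually_ball_finite) auto
  then show ?thesis by eventually_elim auto
qed

text \<open>Dividing \<open>window_telescope\<close> by \<open>gen z\<close> turns each
  \<open>gen_loss\<close> into \<open>kappa k * R_k\<close>, so near \<open>t\<close> on the right
  the quotient equals an expression that is continuous at \<open>t\<close>.\<close>

lemma window_limit:
  assumes t: "0 < t" "\<And>z. t < z \<Longrightarrow> summable_at z" and X: "avoids a X" "length X = p - 1"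
  shows "((\<lambda>z. z ^ (p - 1) * gen_end X z / gen z) \<longlongrightarrow>
    1 - t * (\<Sum>k<length ws. kappa k * R_fun a r m k t * corr_val (tl (ws ! k)) X t)) (at_right t)"
proof -
  let ?g = "\<lambda>z. 1 - z * (\<Sum>k<length ws. kappa k * R_fun a r m k z * corr_val (tl (ws ! k)) X z)"
  have "(R_fun a r m k \<longlongrightarrow> R_fun a r m k t) (at_right t)" if "k < length ws" for k
    using regular_at_isCont[OF R_fun_regular_at[OF t that]]
    by (auto simp: isCont_def intro: filterlim_mono[OF _ order_refl at_le])
  then have "(?g \<longlongrightarrow> ?g t) (at_right t)" by (intro tendsto_intros) auto
  moreover have ev: "\<forall>\<^sub>F z in at_right t. \<forall>k<length ws. kappa k * R_fun a r m k z = gen_loss (ws ! k) z / gen z"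
    by (rule R_fun_eventually) (use t in auto)
  have right: "\<forall>\<^sub>F z in at_right t. t < z" by (simp add: eventually_at_right_less)
  have "\<forall>\<^sub>F z in at_right t. ?g z = z ^ (p - 1) * gen_end X z / gen z"
    using ev right
  proof eventually_elim
    case (elim z)
    have g: "0 < gen z" by (rule gen_pos[OF t(2)[OF elim(2)]])
    have "?g z = 1 - z * (\<Sum>k<length ws. gen_loss (ws ! k) z / gen z * corr_val (tl (ws ! k)) X z)"
      using elim(1) by simp
    also have "\<dots> = 1 - z * (\<Sum>k<length ws. gen_loss (ws ! k) z * corr_val (tl (ws ! k)) X z) / gen z"
      by (simp add: sum_divide_distrib sum_distrib_left)
    also have "\<dots> = z ^ (p - 1) * gen_end X z / gen z"
      unfolding window_telescope[OF t(2)[OF elim(2)] X] using g by (simp add: diff_divide_distrib)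
    finally show ?case .
  qed
  ultimately show ?thesis by (rule Lim_transform_eventually)
qed

text \<open>Apply \<open>window_limit\<close> to the reversed words. Reversal turns the overlap into
  that of \<open>X\<close> over \<open>ws ! k\<close>, and since no word of the collection lies in
  \<open>X\<close>, it is \<open>t\<close> times the correlation of the full words; so nothing is
  truncated in \<open>V\<close>.\<close>

lemma window_limit_start:
  assumes t: "0 < t" "\<And>z. t < z \<Longrightarrow> summable_at z" and X: "avoids a X" "length X = p - 1"
  shows "((\<lambda>z. z ^ (p - 1) * gen_start X z / gen z) \<longlongrightarrow>
    1 - t * (\<Sum>k<length ws. kappa k * S_fun a r m k t * corr_val X (ws ! k) t)) (at_right t)"
proof -
  interpret R: weighted_words "map rev a" "map rev r" m p by (rule reverse)
  have rX: "avoids (map rev a) (rev X)" "length (rev X) = p - 1" using X by (simp_all add: avoids_rev)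
  have kap: "R.kappa = kappa" by (simp add: fun_eq_iff R.kappa_def kappa_def)
  have corr: "corr_val (tl (R.ws ! k)) (rev X) t = corr_val X (ws ! k) t" if k: "k < length ws" for k
  proof -
    have rk: "R.ws ! k = rev (ws ! k)" using k by (simp flip: map_append)
    have "R.ws ! k \<in> set R.ws" using k by (intro nth_mem) simp
    then have "t * corr_val (tl (R.ws ! k)) (rev X) t = overlap (rev (ws ! k)) (rev X) t"
      using R.window_overlap[OF rX] unfolding rk by metis
    also have "\<dots> = t * corr_val X (ws ! k) t"
      unfolding overlap_rev
      using no_word_in_window[OF X nth_mem[OF k]] by (intro overlap_corr_val[symmetric]) simp
    finally show ?thesis using t by simp
  qed
  have "((\<lambda>z. z ^ (p - 1) * R.gen_end (rev X) z / R.gen z) \<longlongrightarrow>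
    1 - t * (\<Sum>k<length R.ws. R.kappa k * R_fun (map rev a) (map rev r) m k t *
      corr_val (tl (R.ws ! k)) (rev X) t)) (at_right t)"
    using t reverse_summable by (intro R.window_limit rX) auto
  moreover have "(\<Sum>k<length R.ws. R.kappa k * R_fun (map rev a) (map rev r) m k t * corr_val (tl (R.ws ! k)) (rev X) t) =
      (\<Sum>k<length ws. kappa k * S_fun a r m k t * corr_val X (ws ! k) t)"
    by (intro sum.cong) (simp_all add: S_fun_eq kap corr del: append_eq_append_conv)
  ultimately show ?thesis by (simp only: reverse_gen reverse_gen_end)
qed

text \<open>In the variable \<open>1 / z\<close> the function is a power series with coefficients
  \<open>weight_count\<close>, differentiated termwise; \<open>N\<close> is
  \<open>- z * gen' z\<close>.\<close>

lemma gen_derivative: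
  assumes t: "0 < t" "\<And>z. t < z \<Longrightarrow> summable_at z" and z: "t < z"
  obtains N where "(\<lambda>n. real n * weight_count n * (1 / z) ^ n) sums N"
    "(gen has_real_derivative - N / z) (at z)"
proof -
  let ?c = weight_count
  define \<Phi> where "\<Phi> = (\<lambda>y. \<Sum>n. ?c n * y ^ n)"
  define D where "D = (\<Sum>n. diffs ?c n * (1 / z) ^ n)"
  \<comment> \<open>The series converges at \<open>1 / s\<close>, strictly beyond
    \<open>1 / z\<close>, which permits termwise differentiation.\<close>
  obtain s where s: "t < s" "s < z" using z dense by blast
  have z0: "0 < z" using z t by simp
  have gen: "gen z = \<Phi> (1 / z)" if "t < z" for z
    using gen_sums[OF t(2)[OF that]] by (simp add: \<Phi>_def sums_iff)
  have sm: "summable (\<lambda>n. ?c n * (1 / s) ^ n)" using gen_sums[OF t(2)[OF s(1)]] by (simp add: sums_iff)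
  have lt: "norm (1 / z) < norm (1 / s)" using s t by (simp add: frac_less2)
  have "(\<Phi> has_real_derivative D) (at (1 / z))"
    unfolding \<Phi>_def D_def by (rule termdiffs_strong[OF sm lt])
  moreover have "((\<lambda>z. 1 / z) has_real_derivative - (1 / z ^ 2)) (at z)"
    using z0 by (auto intro!: derivative_eq_intros simp: power2_eq_square)
  ultimately have "((\<lambda>z. \<Phi> (1 / z)) has_real_derivative D * - (1 / z ^ 2)) (at z)"
    by (rule DERIV_chain2)
  then have D: "(gen has_real_derivative D * - (1 / z ^ 2)) (at z)"
    by (rule has_field_derivative_transform_within_open[where S = "{t<..}"]) (use z gen in auto)
  have "summable (\<lambda>n. diffs ?c n * (1 / z) ^ n)"
    by (rule termdiff_converges[OF lt]) (rule powser_inside[OF sm])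
  then have "(\<lambda>n. diffs ?c n * (1 / z) ^ n) sums D" by (simp add: D_def summable_sums)
  then have "(\<lambda>n. diffs ?c n * (1 / z) ^ n * (1 / z)) sums (D * (1 / z))" by (rule sums_mult2)
  then have "(\<lambda>n. real (Suc n) * ?c (Suc n) * (1 / z) ^ Suc n) sums (D * (1 / z))"
    by (simp add: diffs_def mult_ac)
  then have "(\<lambda>n. real n * ?c n * (1 / z) ^ n) sums (D * (1 / z))"
    by (subst (asm) sums_Suc_iff) simp
  moreover have "D * - (1 / z ^ 2) = - (D * (1 / z)) / z" by (simp add: power2_eq_square)
  ultimately show ?thesis using that D by metis
qed

end

section \<open>The scalar product\<close>

context weighted_words
begin

lemma R_total_regular_at:
  assumes "0 < t" "\<And>z. t < z \<Longrightarrow> summable_at z"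
  shows "regular_at t (R_total a r m)"
proof -
  have "regular_at t (\<lambda>z. poly [:0, 1:] z * (\<Sum>k<length ws. poly [:kappa k:] z * R_fun a r m k z))"
    using assms by (intro regular_at_mult regular_at_sum regular_at_poly R_fun_regular_at) auto
  then show ?thesis by (simp add: R_total_eq[abs_def])
qed

lemma gen_R_total:
  assumes t: "0 < t" "\<And>z. t < z \<Longrightarrow> summable_at z"
  shows "\<forall>\<^sub>F z in at_right t. (z - real (card (UNIV :: 'a set)) + R_total a r m z) * gen z = z"
proof -
  have ev: "\<forall>\<^sub>F z in at_right t. \<forall>k<length ws. kappa k * R_fun a r m k z = gen_loss (ws ! k) z / gen z"
    by (rule R_fun_eventually) (use t in auto)
  have right: "\<forall>\<^sub>F z in at_right t. t < z" by (simp add: eventually_at_right_less)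
  from ev right show ?thesis
  proof eventually_elim
    case (elim z)
    have g: "0 < gen z" by (rule gen_pos[OF t(2)[OF elim(2)]])
    have "R_total a r m z = z * (\<Sum>k<length ws. gen_loss (ws ! k) z / gen z)"
      unfolding R_total_eq using elim(1) by simp
    also have "\<dots> = z * (\<Sum>k<length ws. gen_loss (ws ! k) z) / gen z"
      by (simp flip: sum_divide_distrib)
    finally have "R_total a r m z * gen z = z * (\<Sum>k<length ws. gen_loss (ws ! k) z)"
      using g by simp
    then show ?case using gen_total[OF t(2)[OF elim(2)]] by (simp add: algebra_simps)
  qed
qed

text \<open>Gluing a word ending in \<open>X\<close> to a word starting with \<open>X\<close> gives a word with a marked window, so the
  sum over \<open>X\<close> is essentially \<open>- z * gen' z\<close>, and \<open>gen z = z / (z - q + R z)\<close>.\<close>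

lemma glue_limit:
  assumes t: "0 < t" "\<And>z. t < z \<Longrightarrow> summable_at z" and top: "filterlim gen at_top (at_right t)"
    and R': "(R_total a r m has_real_derivative R') (at t)"
  shows "((\<lambda>z. z ^ (p - 1) * (\<Sum>X | length X = p - 1. gen_end X z * gen_start X z) / gen z ^ 2)
    \<longlongrightarrow> 1 + R') (at_right t)"
proof -
  define d where "d = p - 1"
  let ?q = "real (card (UNIV :: 'a set))"
  let ?S = "\<lambda>z. z ^ d * (\<Sum>X | length X = d. gen_end X z * gen_start X z)"
  obtain h' where h': "\<forall>\<^sub>F z in nhds t. (R_total a r m has_real_derivative h' z) (at z)" "isCont h' t"
    using regular_at_derivative[OF R_total_regular_at[OF t(1)]] t(2) by metis
  have h't: "h' t = R'"
    using eventually_nhds_x_imp_x[OF h'(1)] R' by (rule DERIV_unique)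
  have der: "\<forall>\<^sub>F z in at_right t. (R_total a r m has_real_derivative h' z) (at z)"
    using h'(1) unfolding eventually_at_filter by eventually_elim simp
  have right: "\<forall>\<^sub>F z in at_right t. t < z" by (simp add: eventually_at_right_less)
  \<comment> \<open>An open interval is needed, since the identity is differentiated at each
    \<open>z\<close> in it.\<close>
  obtain b where b: "t < b" and eq: "\<And>z. t < z \<Longrightarrow> z < b \<Longrightarrow> (z - ?q + R_total a r m z) * gen z = z"
    using gen_R_total[OF t(1)] t(2) unfolding eventually_at_right_field by metis
  have ltb: "\<forall>\<^sub>F z in at_right t. z < b"
    using b unfolding eventually_at_right_field by auto
  \<comment> \<open>For words shorter than \<open>d\<close> the truncated count
    \<open>Suc n - d\<close> is 0 instead of \<open>n + 1 - d\<close>; this finite sum makes up the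
    difference and stays bounded near \<open>t\<close>.\<close>
  define e where "e = (\<lambda>z. \<Sum>n<d. (real d - 1 - real n) * weight_count n * (1 / z) ^ n)"
  have key: "\<forall>\<^sub>F z in at_right t. 1 + h' z - real d * (1 / gen z) + e z * (1 / gen z) ^ 2 = ?S z / gen z ^ 2"
    using der right ltb
  proof eventually_elim
    case (elim z)
    have z: "summable_at z" by (rule t(2)[OF elim(2)])
    have g: "0 < gen z" by (rule gen_pos[OF z])
    have z0: "0 < z" using elim t by simp
    obtain N where N: "(\<lambda>n. real n * weight_count n * (1 / z) ^ n) sums N"
      "(gen has_real_derivative - N / z) (at z)"
      using gen_derivative[OF t(1) _ elim(2)] t(2) by metis
    \<comment> \<open>Both sides of \<open>(z - q + R z) * gen z = z\<close> are differentiated; the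
      identity itself then replaces the coefficient of \<open>N\<close> by a multiple of
      \<open>1 / gen z\<close>.\<close>
    have "((\<lambda>z. (z - ?q + R_total a r m z) * gen z) has_real_derivative
        (1 - 0 + h' z) * gen z + - N / z * (z - ?q + R_total a r m z)) (at z)"
      by (intro DERIV_mult DERIV_add DERIV_diff DERIV_ident DERIV_const elim(1) N(2))
    then have "((\<lambda>z. z) has_real_derivative
        (1 - 0 + h' z) * gen z + - N / z * (z - ?q + R_total a r m z)) (at z)"
      by (rule has_field_derivative_transform_within_open[where S = "{t<..<b}"]) (use elim eq in auto)
    then have "(1 + h' z) * gen z - N / z * (z - ?q + R_total a r m z) = 1"
      using DERIV_unique[OF _ DERIV_ident] by fastforce
    moreover have "z - ?q + R_total a r m z = z / gen z"
      using eq[OF elim(2,3)] g by (simp add: field_simps)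
    ultimately have "(1 + h' z) * gen z - N / gen z = 1" using z0 by simp
    then have N': "N = (1 + h' z) * gen z ^ 2 - gen z"
      using g by (simp add: field_simps power2_eq_square)
    have "(\<lambda>n. real (Suc n - d) * weight_count n * (1 / z) ^ n) sums ?S z"
      using sums_by_length[OF gen_glue[OF z]] by (simp add: d_def)
    moreover have "(\<lambda>n. real n * weight_count n * (1 / z) ^ n + (1 - real d) * (weight_count n * (1 / z) ^ n)
        + (if n \<in> {..<d} then (real d - 1 - real n) * weight_count n * (1 / z) ^ n else 0)) sums
        (N + (1 - real d) * gen z + e z)"
      unfolding e_def by (intro sums_add N sums_mult gen_sums[OF z] sums_If_finite_set) simp
    moreover have "real n * weight_count n * (1 / z) ^ n + (1 - real d) * (weight_count n * (1 / z) ^ n)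
        + (if n \<in> {..<d} then (real d - 1 - real n) * weight_count n * (1 / z) ^ n else 0)
        = real (Suc n - d) * weight_count n * (1 / z) ^ n" for n
    proof (cases "n < d")
      case True
      then show ?thesis by (simp add: algebra_simps)
    next
      case False
      then have "real (Suc n - d) = real n + 1 - real d" by (simp add: of_nat_diff)
      then show ?thesis using False by (simp add: algebra_simps)
    qed
    ultimately have "?S z = N + (1 - real d) * gen z + e z"
      using sums_unique2 by simp
    then show ?case using g unfolding N' by (simp add: field_simps power2_eq_square)
  qed
  have inv: "((\<lambda>z. 1 / gen z) \<longlongrightarrow> 0) (at_right t)"
    using tendsto_inverse_0_at_top[OF top] by (simp add: inverse_eq_divide)
  have "(h' \<longlongrightarrow> R') (at_right t)"
    using h'(2) h't by (auto simp: isCont_def intro: filterlim_mono[OF _ order_refl at_le])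
  moreover have "(e \<longlongrightarrow> e t) (at_right t)"
    unfolding e_def using t by (intro tendsto_intros) auto
  ultimately have "((\<lambda>z. 1 + h' z - real d * (1 / gen z) + e z * (1 / gen z) ^ 2) \<longlongrightarrow>
      1 + R' - real d * 0 + e t * 0 ^ 2) (at_right t)"
    using inv by (intro tendsto_intros)
  then show ?thesis using Lim_transform_eventually[OF _ key] by (simp add: d_def)
qed

text \<open>The sum in \<open>glue_limit\<close> runs over all words of length \<open>p - 1\<close>:
  suitably normalised, the terms of allowed words tend to \<open>U X * V X\<close> and the others to
  0.\<close>

lemma perron_product:
  fixes vs :: "'a list list" and \<theta> :: real
  assumes vs: "distinct vs" "set vs = allowed_words (set a) (p - 1)"
    and letter: "\<exists>c. allowed (set a) [c]"
    and theta: "\<theta> = spectral_radius (adjacency_mat a r m p vs)" "1 < \<theta>"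
  defines "U \<equiv> \<lambda>X. 1 - \<theta> * (\<Sum>k<length ws. kappa k * R_fun a r m k \<theta> * corr_val (tl (ws ! k)) X \<theta>)"
    and "V \<equiv> \<lambda>X. 1 - \<theta> * (\<Sum>k<length ws. kappa k * S_fun a r m k \<theta> * corr_val X (ws ! k) \<theta>)"
  shows "\<exists>R'. (R_total a r m has_real_derivative R') (at \<theta>) \<and>
    (\<Sum>X\<in>allowed_words (set a) (p - 1). U X * V X) = \<theta> ^ (p - 1) * (1 + R')"
proof -
  define d where "d = p - 1"
  have t0: "0 < \<theta>" using theta by simp
  have sm: "summable_at z" if "\<theta> < z" for z by (rule summable_above[OF vs letter theta that])
  have top: "filterlim gen at_top (at_right \<theta>)" by (rule gen_at_top[OF vs letter theta])
  have right: "\<forall>\<^sub>F z in at_right \<theta>. \<theta> < z" by (simp add: eventually_at_right_less)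
  obtain R' where R': "(R_total a r m has_real_derivative R') (at \<theta>)"
    using regular_at_derivative[OF R_total_regular_at[OF t0]] sm eventually_nhds_x_imp_x by metis
  let ?L = "allowed_words (set a) d"
  let ?u = "\<lambda>X z. z ^ d * gen_end X z / gen z" and ?v = "\<lambda>X z. z ^ d * gen_start X z / gen z"
  have allowed: "avoids a X" "length X = d" if "X \<in> ?L" for X
    using that extendable_avoids by (auto simp: allowed_words_def allowed_iff_extendable)
  have inside: "((\<lambda>z. ?u X z * ?v X z) \<longlongrightarrow> U X * V X) (at_right \<theta>)" if "X \<in> ?L" for X
    unfolding U_def V_def d_def using allowed[OF that] unfolding d_def
    by (intro tendsto_mult window_limit window_limit_start t0 sm)
  \<comment> \<open>\<open>gen_end X\<close> may grow as fast as \<open>gen\<close>, but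
    \<open>gen_start X\<close> stays bounded, so the product is at most of order
    \<open>1 / gen z\<close>.\<close>
  have outside: "((\<lambda>z. ?u X z * ?v X z) \<longlongrightarrow> 0) (at_right \<theta>)" if X: "length X = d" "X \<notin> ?L" for X
  proof -
    have "\<not> extendable a X" using X by (simp add: allowed_words_def allowed_iff_extendable)
    then obtain C where C: "\<And>z. 1 \<le> z \<Longrightarrow> gen_start X z \<le> C"
      using gen_start_dead_end X unfolding d_def by metis
    have "((\<lambda>z. z ^ d * z ^ d * C * inverse (gen z)) \<longlongrightarrow> \<theta> ^ d * \<theta> ^ d * C * 0) (at_right \<theta>)"
      by (intro tendsto_intros tendsto_inverse_0_at_top top)
    then have lim: "((\<lambda>z. z ^ d * z ^ d * C * inverse (gen z)) \<longlongrightarrow> 0) (at_right \<theta>)" by simp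
    show ?thesis
    proof (rule tendsto_sandwich[OF _ _ tendsto_const lim])
      show "\<forall>\<^sub>F z in at_right \<theta>. 0 \<le> ?u X z * ?v X z"
        using right
      proof eventually_elim
        case (elim z)
        show ?case
          using gen_pos[OF sm[OF elim]] gen_end_nonneg[OF sm[OF elim], of X]
            gen_start_nonneg[OF sm[OF elim], of X] elim t0 by simp
      qed
      show "\<forall>\<^sub>F z in at_right \<theta>. ?u X z * ?v X z \<le> z ^ d * z ^ d * C * inverse (gen z)"
        using right
      proof eventually_elim
        case (elim z)
        note z = sm[OF elim]
        have g: "0 < gen z" by (rule gen_pos[OF z])
        have z0: "0 < z" using elim t0 by simp
        have "gen_end X z * gen_start X z \<le> gen z * C"
          using gen_end_le[OF z, of X] C[of z] gen_start_nonneg[OF z, of X] g elim theta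
          by (intro mult_mono) auto
        then have "z ^ d * z ^ d * (gen_end X z * gen_start X z) / (gen z * gen z) \<le>
            z ^ d * z ^ d * (gen z * C) / (gen z * gen z)"
          using z0 by (intro divide_right_mono mult_left_mono) auto
        then show ?case using g by (simp add: field_simps)
      qed
    qed
  qed
  have fin: "finite {X :: 'a list. length X = d}" by (rule finite_words)
  have "((\<lambda>z. \<Sum>X | length X = d. ?u X z * ?v X z) \<longlongrightarrow>
      (\<Sum>X | length X = d. if X \<in> ?L then U X * V X else 0)) (at_right \<theta>)"
    by (intro tendsto_sum) (use inside outside in auto)
  also have "(\<Sum>X | length X = d. if X \<in> ?L then U X * V X else 0) = (\<Sum>X\<in>?L. U X * V X)"
    using allowed(2) fin by (intro sum.mono_neutral_cong_right) auto
  finally have lim1: "((\<lambda>z. \<Sum>X | length X = d. ?u X z * ?v X z) \<longlongrightarrow> (\<Sum>X\<in>?L. U X * V X)) (at_right \<theta>)" .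
  \<comment> \<open>The two window limits carry a factor \<open>z ^ d\<close> each,
    \<open>glue_limit\<close> only one; the other becomes \<open>\<theta> ^ (p - 1)\<close>.\<close>
  have "((\<lambda>z. z ^ d * (z ^ d * (\<Sum>X | length X = d. gen_end X z * gen_start X z) / gen z ^ 2)) \<longlongrightarrow>
      \<theta> ^ d * (1 + R')) (at_right \<theta>)"
    unfolding d_def by (intro tendsto_intros glue_limit t0 sm top R')
  moreover have "(\<lambda>z. z ^ d * (z ^ d * (\<Sum>X | length X = d. gen_end X z * gen_start X z) / gen z ^ 2)) =
      (\<lambda>z. \<Sum>X | length X = d. ?u X z * ?v X z)"
    by (simp add: fun_eq_iff sum_distrib_left sum_divide_distrib power2_eq_square mult_ac)
  ultimately have "(\<Sum>X\<in>?L. U X * V X) = \<theta> ^ d * (1 + R')"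
    using tendsto_unique[OF trivial_limit_at_right_real lim1] by simp
  then show ?thesis using R' unfolding d_def by blast
qed

end

theorem theorem6p8:
  fixes a r vs :: "'a::finite list list" and m :: "nat list" and p :: nat
    and \<theta> :: real and U V :: "real vec"
  assumes alphabet: "card (UNIV :: 'a set) \<ge> 2"
    and forbidden: "distinct a" "reduced (set a)" "\<forall>w\<in>set a. length w \<ge> 2"
    and symbols_allowed: "\<forall>c. allowed (set a) [c]"
    and irreducible: "irreducible_shift (set a)"
    and repeated: "distinct r" "reduced (set r)" "\<forall>w\<in>set r. allowed (set a) w"
    and multiplicities: "length m = length r" "\<forall>k\<in>set m. k \<ge> 2"
    and p_longest: "set a \<union> set r \<noteq> {}" "p = Max (length ` (set a \<union> set r))" "p \<ge> 2"
    and same_length: "\<forall>w\<in>set r. length w = p"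
    and vertices: "distinct vs" "set vs = allowed_words (set a) (p - 1)"
    and perron_root: "\<theta> = spectral_radius (adjacency_mat a r m p vs)" "\<theta> > 1"
    and U_formula: "U = vec (length vs) (\<lambda>x. 1
      - \<theta> * (\<Sum>i<length r. (1 - 1 / real (m ! i)) * R_fun a r m i \<theta> * corr_val (tl (r ! i)) (vs ! x) \<theta>)
      + \<theta> * (\<Sum>j<length a. R_fun a r m (length r + j) \<theta> * corr_val (tl (a ! j)) (vs ! x) \<theta>))"
    and V_formula: "V = vec (length vs) (\<lambda>x. 1
      - \<theta> * (\<Sum>i<length r. (1 - 1 / real (m ! i)) * S_fun a r m i \<theta> * corr_val (vs ! x) (r ! i) \<theta>)
      + \<theta> * (\<Sum>j<length a. S_fun a r m (length r + j) \<theta> * corr_val (vs ! x) (a ! j) \<theta>))"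
    and prop_P: "property_P a r m p"
  shows "\<exists>R'. (R_total a r m has_real_derivative R') (at \<theta>) \<and>
              scalar_prod U V = \<theta> ^ (p - 1) * (1 + R')"
proof -
  have le_p: "length w \<le> p" if "w \<in> set a \<union> set r" for w
    using that unfolding p_longest(2) by (intro Max_ge) auto
  \<comment> \<open>A repeated word is allowed, hence contains no forbidden word.\<close>
  have avoid: "\<not> sublist u w" if "w \<in> set r" "u \<in> set a" for u w
  proof -
    have "avoids a w"
      using that repeated(3) extendable_avoids by (auto simp: allowed_iff_extendable)
    then show ?thesis using that by (auto simp: avoids_def)
  qed
  \<comment> \<open>A forbidden word has at most \<open>p\<close> letters, so if it contained a word
    of length \<open>p\<close> the two would be equal.\<close>
  have avoid': "\<not> sublist w u" if "w \<in> set r" "u \<in> set a" for u w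
  proof
    assume sub: "sublist w u"
    then have "length u \<le> length w" using le_p[of u] same_length that by simp
    then have "w = u" using sub by (auto simp: sublist_def)
    then show False using avoid[OF that] by simp
  qed
  interpret weighted_words a r m p
  proof
    show "distinct (r @ a)"
      using forbidden(1) repeated(1) avoid by auto
    show "u = v" if "u \<in> set (r @ a)" "v \<in> set (r @ a)" "sublist u v" for u v
      using that avoid avoid' forbidden(2) repeated(2) unfolding reduced_def by auto
    show "2 \<le> length u \<and> length u \<le> p" if "u \<in> set (r @ a)" for u
      using that forbidden(3) same_length p_longest(3) le_p by auto
  qed (use same_length p_longest(3) multiplicities in auto)
  let ?U = "\<lambda>X. 1 - \<theta> * (\<Sum>k<length ws. kappa k * R_fun a r m k \<theta> * corr_val (tl (ws ! k)) X \<theta>)"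
  let ?V = "\<lambda>X. 1 - \<theta> * (\<Sum>k<length ws. kappa k * S_fun a r m k \<theta> * corr_val X (ws ! k) \<theta>)"
  \<comment> \<open>\<open>kappa\<close> is -1 on forbidden words, which merges the two sums of
    opposite sign into one.\<close>
  have U: "U = vec (length vs) (\<lambda>x. ?U (vs ! x))"
    unfolding U_formula sum_words by (simp add: kappa_def nth_append sum_negf algebra_simps)
  have V: "V = vec (length vs) (\<lambda>x. ?V (vs ! x))"
    unfolding V_formula sum_words by (simp add: kappa_def nth_append sum_negf algebra_simps)
  have "scalar_prod U V = (\<Sum>x<length vs. ?U (vs ! x) * ?V (vs ! x))"
    unfolding U V by (simp add: scalar_prod_def lessThan_atLeast0)
  also have "\<dots> = (\<Sum>X\<in>allowed_words (set a) (p - 1). ?U X * ?V X)"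
    by (rule sum_allowed[OF vertices _ perron_root, symmetric]) (use symbols_allowed in blast)
  finally show ?thesis
    using perron_product[OF vertices _ perron_root] symbols_allowed by auto
qed

end
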